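(* Let $\varphi$ be a nondegenerate Orlicz function and let $w$ be a weight sequence. Then the order-continuous subspace $(\lambda_{\varphi,w})_a$ is an M-ideal in the Orlicz-Lorentz sequence space $\lambda_{\varphi,w}$ equipped with the Luxemburg norm.
   Context: All Banach spaces are real. An Orlicz function is a convex function $\varphi:[0,\infty)\to[0,\infty)$ with $\varphi(0)=0$, not identically zero; it is nondegenerate if $\varphi(u)>0$ for all $u>0$. A weight sequence is a decreasing (i.e. non-increasing) sequence $w=(w(i))_{i\in\mathbb{N}}$ of positive reals with $\sum_{i=1}^\infty w(i)=\infty$. For a real sequence $x$, $d_x(\lambda)$ is the number of $i\in\mathbb{N}$ with $|x(i)|>\lambda$, and $x^*(i)=\inf\{\lambda>0:d_x(\lambda)<i\}$. Put $\alpha_{\varphi,w}(x)=\sum_{i=1}^\infty\varphi(x^*(i))w(i)$. Then $\lambda_{\varphi,w}=\{x:\alpha_{\varphi,w}(kx)<\infty\text{ for some }k>0\}$ with the Luxemburg norm $\|x\|_{\varphi,w}=\inf\{\epsilon>0:\alpha_{\varphi,w}(x/\epsilon)\le 1\}$. For a Banach sequence lattice $X$, $X_a$ is the closed subspace of order-continuous elements: $x\in X$ such that $\|x_n\|_X\downarrow 0$ for every sequence $(x_n)$ with $0\le x_n\le|x|$ and $x_n\downarrow 0$ pointwise. A closed subspace $Y$ of a Banach space $X$ is an M-ideal in $X$ if its annihilator $Y^\perp\subset X^*$ is the range of a bounded projection $P:X^*\to X^*$ such that $\|F\|=\|P(F)\|+\|F-P(F)\|$ for all $F\in X^*$. *)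

theory Defs
  imports "HOL-Analysis.Analysis" "HOL-Library.Function_Algebras"
begin

subsection \<open>Functions as a real vector space\<close>

instantiation "fun" :: (type, real_vector) real_vector
begin

definition scaleR_fun :: "real \<Rightarrow> ('a \<Rightarrow> 'b) \<Rightarrow> 'a \<Rightarrow> 'b"
  where "scaleR_fun c f = (\<lambda>x. c *\<^sub>R f x)"

instance
  by standard (simp_all add: scaleR_fun_def fun_eq_iff scaleR_add_right scaleR_add_left)

end

subsection \<open>Normed spaces given by a carrier and a norm function\<close>

text \<open>
  The Orlicz-Lorentz space depends on \<open>\<phi>\<close> and \<open>w\<close>, so it cannot be a type.  A normed
  space is therefore a linear subspace \<open>X\<close> of a real vector space with a function \<open>N\<close>
  whose values matter only on \<open>X\<close>.
\<close>

definition normed_space_on :: "'a::real_vector set \<Rightarrow> ('a \<Rightarrow> real) \<Rightarrow> bool" where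
  "normed_space_on X N \<longleftrightarrow> subspace X \<and>
     (\<forall>x\<in>X. 0 \<le> N x \<and> (N x = 0 \<longleftrightarrow> x = 0)) \<and>
     (\<forall>c. \<forall>x\<in>X. N (c *\<^sub>R x) = \<bar>c\<bar> * N x) \<and>
     (\<forall>x\<in>X. \<forall>y\<in>X. N (x + y) \<le> N x + N y)"

text \<open>The value 0 off \<open>X\<close> is there because \<^locale>\<open>Metric_space\<close> asks for nonnegativity and
  symmetry on the whole type.\<close>

definition norm_dist :: "'a::real_vector set \<Rightarrow> ('a \<Rightarrow> real) \<Rightarrow> 'a \<Rightarrow> 'a \<Rightarrow> real" where
  "norm_dist X N x y = (if x \<in> X \<and> y \<in> X then N (x - y) else 0)"

definition banach_space_on :: "'a::real_vector set \<Rightarrow> ('a \<Rightarrow> real) \<Rightarrow> bool" where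
  "banach_space_on X N \<longleftrightarrow>
     normed_space_on X N \<and> Metric_space.mcomplete X (norm_dist X N)"

definition closed_subspace_of :: "'a::real_vector set \<Rightarrow> 'a set \<Rightarrow> ('a \<Rightarrow> real) \<Rightarrow> bool" where
  "closed_subspace_of Y X N \<longleftrightarrow>
     subspace Y \<and> Y \<subseteq> X \<and> closedin (Metric_space.mtopology X (norm_dist X N)) Y"

definition bounded_linear_between ::
  "'a::real_vector set \<Rightarrow> ('a \<Rightarrow> real) \<Rightarrow> 'b::real_vector set \<Rightarrow> ('b \<Rightarrow> real) \<Rightarrow> ('a \<Rightarrow> 'b) \<Rightarrow> bool"
where
  "bounded_linear_between X N Z M T \<longleftrightarrow> T ` X \<subseteq> Z \<and>
     (\<forall>x\<in>X. \<forall>y\<in>X. T (x + y) = T x + T y) \<and>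
     (\<forall>c. \<forall>x\<in>X. T (c *\<^sub>R x) = c *\<^sub>R T x) \<and>
     (\<exists>C. \<forall>x\<in>X. M (T x) \<le> C * N x)"

text \<open>Functionals on \<open>X\<close> are represented by total functions vanishing outside \<open>X\<close>, so that
  two functionals are equal iff they agree on \<open>X\<close> and the dual is again a linear space
  under pointwise operations.\<close>

definition dual_space :: "'a::real_vector set \<Rightarrow> ('a \<Rightarrow> real) \<Rightarrow> ('a \<Rightarrow> real) set" where
  "dual_space X N =
     {F. bounded_linear_between X N UNIV norm F \<and> (\<forall>x. x \<notin> X \<longrightarrow> F x = 0)}"

definition dual_norm :: "'a::real_vector set \<Rightarrow> ('a \<Rightarrow> real) \<Rightarrow> ('a \<Rightarrow> real) \<Rightarrow> real" where
  "dual_norm X N F = (SUP x\<in>{x\<in>X. N x \<le> 1}. \<bar>F x\<bar>)"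

definition annihilator ::
  "'a::real_vector set \<Rightarrow> ('a \<Rightarrow> real) \<Rightarrow> 'a set \<Rightarrow> ('a \<Rightarrow> real) set" where
  "annihilator X N Y = {F \<in> dual_space X N. \<forall>y\<in>Y. F y = 0}"

definition M_ideal :: "'a::real_vector set \<Rightarrow> 'a set \<Rightarrow> ('a \<Rightarrow> real) \<Rightarrow> bool" where
  "M_ideal Y X N \<longleftrightarrow> banach_space_on X N \<and> closed_subspace_of Y X N \<and>
     (\<exists>P. bounded_linear_between
            (dual_space X N) (dual_norm X N) (dual_space X N) (dual_norm X N) P \<and>
          (\<forall>F\<in>dual_space X N. P (P F) = P F) \<and>
          P ` dual_space X N = annihilator X N Y \<and>
          (\<forall>F\<in>dual_space X N.
             dual_norm X N F = dual_norm X N (P F) + dual_norm X N (F - P F)))"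

text \<open>When \<open>X\<close> is a sequence lattice it is solid, so the \<open>s n\<close> below lie in \<open>X\<close>.\<close>

definition order_continuous_part ::
  "(nat \<Rightarrow> real) set \<Rightarrow> ((nat \<Rightarrow> real) \<Rightarrow> real) \<Rightarrow> (nat \<Rightarrow> real) set" where
  "order_continuous_part X N = {x\<in>X. \<forall>s :: nat \<Rightarrow> nat \<Rightarrow> real.
     (\<forall>n i. 0 \<le> s n i \<and> s n i \<le> \<bar>x i\<bar>) \<and>
     (\<forall>i. decseq (\<lambda>n. s n i) \<and> (\<lambda>n. s n i) \<longlonglongrightarrow> 0) \<longrightarrow>
     decseq (\<lambda>n. N (s n)) \<and> (\<lambda>n. N (s n)) \<longlonglongrightarrow> 0}"

subsection \<open>Orlicz-Lorentz sequence spaces\<close>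

definition orlicz_function :: "(real \<Rightarrow> real) \<Rightarrow> bool" where
  "orlicz_function \<phi> \<longleftrightarrow> convex_on {0..} \<phi> \<and> (\<forall>u\<ge>0. 0 \<le> \<phi> u) \<and> \<phi> 0 = 0 \<and>
     (\<exists>u\<ge>0. \<phi> u \<noteq> 0)"

definition nondegenerate :: "(real \<Rightarrow> real) \<Rightarrow> bool" where
  "nondegenerate \<phi> \<longleftrightarrow> (\<forall>u>0. \<phi> u > 0)"

text \<open>Sequences are indexed from 0: the value at \<open>i\<close> is the term with number \<open>i + 1\<close> in
  the one-based notation.\<close>

definition weight_sequence :: "(nat \<Rightarrow> real) \<Rightarrow> bool" where
  "weight_sequence w \<longleftrightarrow> decseq w \<and> (\<forall>i. w i > 0) \<and> \<not> summable w"

definition distribution_fun :: "(nat \<Rightarrow> real) \<Rightarrow> real \<Rightarrow> ennreal" where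
  "distribution_fun x l = emeasure (count_space UNIV) {i. \<bar>x i\<bar> > l}"

text \<open>For an unbounded sequence the infimum is over the empty set and equals \<open>\<infinity>\<close>.\<close>

definition decreasing_rearrangement :: "(nat \<Rightarrow> real) \<Rightarrow> nat \<Rightarrow> ennreal" where
  "decreasing_rearrangement x i =
     (INF l\<in>{l. l > 0 \<and> distribution_fun x l < of_nat (Suc i)}. ennreal l)"

text \<open>Extension with \<open>\<phi>(\<infinity>) = \<infinity>\<close>, the limit at infinity of any Orlicz function.\<close>

definition orlicz_ext :: "(real \<Rightarrow> real) \<Rightarrow> ennreal \<Rightarrow> ennreal" where
  "orlicz_ext \<phi> t = (if t = \<infinity> then \<infinity> else ennreal (\<phi> (enn2real t)))"

definition orlicz_lorentz_modular ::
  "(real \<Rightarrow> real) \<Rightarrow> (nat \<Rightarrow> real) \<Rightarrow> (nat \<Rightarrow> real) \<Rightarrow> ennreal" where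
  "orlicz_lorentz_modular \<phi> w x =
     (\<Sum>i. orlicz_ext \<phi> (decreasing_rearrangement x i) * ennreal (w i))"

definition orlicz_lorentz_space ::
  "(real \<Rightarrow> real) \<Rightarrow> (nat \<Rightarrow> real) \<Rightarrow> (nat \<Rightarrow> real) set" where
  "orlicz_lorentz_space \<phi> w = {x. \<exists>k>0. orlicz_lorentz_modular \<phi> w (k *\<^sub>R x) < \<infinity>}"

definition luxemburg_norm ::
  "(real \<Rightarrow> real) \<Rightarrow> (nat \<Rightarrow> real) \<Rightarrow> (nat \<Rightarrow> real) \<Rightarrow> real" where
  "luxemburg_norm \<phi> w x = Inf {\<epsilon>. \<epsilon> > 0 \<and> orlicz_lorentz_modular \<phi> w (x /\<^sub>R \<epsilon>) \<le> 1}"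

end

theory Submission
  imports Defs
begin

text \<open>
  Since \<open>w\<close> is decreasing, the Orlicz-Lorentz modular of \<open>x\<close> is the supremum of the sums
  \<open>\<Sum>i\<in>A. \<phi> \<bar>x (\<sigma> i)\<bar> * w i\<close> over finite \<open>A\<close> and injective \<open>\<sigma>\<close>. Hence it is convex, lower
  semicontinuous under pointwise convergence and subadditive on disjointly supported sequences,
  and it tends to 0 along the tails of any \<open>x\<close> at which it is finite, because such an \<open>x\<close> tends
  to 0.

  For every modular with these properties the order-continuous part is the closure of the finitely
  supported sequences. A functional \<open>F\<close> splits into \<open>R x = (\<Sum>i. x i * F (unit_seq i))\<close> and
  \<open>S = F - R\<close>, which ignores finitely many coordinates, and the projection is \<open>F \<mapsto> S\<close>. Given
  \<open>x\<close>, \<open>y\<close> in the unit ball, cut \<open>x\<close>, slightly shrunk, to finite support and \<open>y\<close> to a tail so far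
  out that its modular fills at most the gap to 1. The sum \<open>z\<close> of the two is still in the unit ball
  and \<open>F z\<close> is close to \<open>R x + S y\<close>; therefore the norms of \<open>R\<close> and \<open>S\<close> add up to at most that
  of \<open>F\<close>.
\<close>

subsection \<open>Orlicz functions\<close>

lemma orlicz_nonneg: "orlicz_function \<phi> \<Longrightarrow> 0 \<le> u \<Longrightarrow> 0 \<le> \<phi> u"
  by (simp add: orlicz_function_def)

lemma orlicz_zero: "orlicz_function \<phi> \<Longrightarrow> \<phi> 0 = 0"
  by (simp add: orlicz_function_def)

lemma orlicz_convex:
  assumes "orlicz_function \<phi>" "0 \<le> u" "0 \<le> v" "0 \<le> t" "t \<le> 1"
  shows "\<phi> ((1 - t) * u + t * v) \<le> (1 - t) * \<phi> u + t * \<phi> v"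
  using assms convex_onD[of "{0..}" \<phi> t u v] by (simp add: orlicz_function_def)

lemma orlicz_scale:
  assumes "orlicz_function \<phi>" "0 \<le> u" "0 \<le> t" "t \<le> 1"
  shows "\<phi> (t * u) \<le> t * \<phi> u"
  using orlicz_convex[OF assms(1) order_refl assms(2-4)] orlicz_zero[OF assms(1)] by simp

lemma orlicz_mono:
  assumes "orlicz_function \<phi>" "0 \<le> u" "u \<le> v"
  shows "\<phi> u \<le> \<phi> v"
proof (cases "v = 0")
  case False
  with assms have "v > 0" "u / v \<le> 1" "0 \<le> u / v" by auto
  then have "\<phi> u \<le> u / v * \<phi> v"
    using orlicz_scale[OF assms(1), of v "u / v"] assms by simp
  also have "\<dots> \<le> \<phi> v"
    using \<open>u / v \<le> 1\<close> orlicz_nonneg[OF assms(1), of v] assms \<open>v > 0\<close>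
    by (intro mult_left_le_one_le) auto
  finally show ?thesis .
qed (use assms in auto)

text \<open>Convexity and \<open>\<phi> 0 = 0\<close> give
  \<open>\<phi> d \<le> d * \<phi> 1\<close> for \<open>d \<le> 1\<close>, which excludes a jump at
  0.\<close>

lemma orlicz_small:
  assumes "orlicz_function \<phi>" "e > 0"
  obtains d where "d > 0" "\<phi> d < e"
proof -
  \<comment> \<open>The summand 1 keeps the denominator positive even if \<open>\<phi> 1\<close> is
    0.\<close>
  define d where "d = min 1 (e / (2 * (\<phi> 1 + 1)))"
  have p: "0 \<le> \<phi> 1" using orlicz_nonneg[OF assms(1), of 1] by simp
  have "d > 0" using p assms by (simp add: d_def)
  have "\<phi> d \<le> d * \<phi> 1"
    using orlicz_scale[OF assms(1), of 1 d] \<open>d > 0\<close> by (simp add: d_def)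
  also have "\<dots> \<le> e / (2 * (\<phi> 1 + 1)) * \<phi> 1"
    using p by (intro mult_right_mono) (auto simp: d_def)
  also have "\<dots> \<le> e / 2"
    using p assms by (simp add: field_simps)
  also have "\<dots> < e" using assms by simp
  finally show ?thesis using that \<open>d > 0\<close> by blast
qed

text \<open>Convexity alone gives continuity only in the interior of the half-line. At the endpoint
  0, monotonicity and \<open>orlicz_small\<close> take over.\<close>

lemma orlicz_continuous_on:
  assumes "orlicz_function \<phi>"
  shows "continuous_on {0..} \<phi>"
proof -
  have cont: "continuous_on {0<..} \<phi>"
  proof (rule convex_on_continuous)
    show "convex_on {0<..} \<phi>"
      using assms convex_on_subset[of "{0..}" \<phi> "{0<..}"] by (simp add: orlicz_function_def Ioi_le_Ico)
  qed simp
  have pos: "continuous (at u within {0..}) \<phi>" if "u > 0" for u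
  proof (rule continuous_at_imp_continuous_at_within)
    show "continuous (at u) \<phi>"
      by (rule continuous_on_interior[OF cont]) (simp add: that interior_open)
  qed
  have "continuous (at 0 within {0..}) \<phi>"
    unfolding continuous_within_eps_delta
  proof (intro allI impI)
    fix e :: real assume "e > 0"
    then obtain d where d: "d > 0" "\<phi> d < e" using orlicz_small[OF assms] by blast
    have "dist (\<phi> u) (\<phi> 0) < e" if "u \<in> {0..}" "dist u 0 < d" for u
      using orlicz_mono[OF assms, of u d] orlicz_nonneg[OF assms, of u] orlicz_zero[OF assms] that d
      by (simp add: dist_real_def)
    then show "\<exists>d>0. \<forall>x'\<in>{0..}. dist x' 0 < d \<longrightarrow> dist (\<phi> x') (\<phi> 0) < e"
      using d by blast
  qed
  with pos show ?thesis
    unfolding continuous_on_eq_continuous_within by (auto simp: order_le_less)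
qed

lemma orlicz_tendsto:
  assumes "orlicz_function \<phi>" "u \<longlonglongrightarrow> l" "\<And>k. 0 \<le> u k"
  shows "(\<lambda>k. \<phi> (u k)) \<longlonglongrightarrow> \<phi> l"
proof -
  have "0 \<le> l" using assms by (intro LIMSEQ_le_const) auto
  then show ?thesis
    using continuous_on_tendsto_compose[OF orlicz_continuous_on[OF assms(1)] assms(2)] assms(3)
    by simp
qed

text \<open>Convexity forces growth at least along the line through 0 with slope
  \<open>\<phi> 1\<close>. Hence the value of \<open>orlicz_ext\<close> at infinity is a limit of
  finite values of \<phi>.\<close>

lemma orlicz_at_top:
  assumes "orlicz_function \<phi>" "nondegenerate \<phi>"
  shows "filterlim (\<lambda>k. \<phi> (real (Suc k))) at_top sequentially"
proof (rule filterlim_at_top_mono)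
  have p: "\<phi> 1 > 0" using assms by (simp add: nondegenerate_def)
  show "filterlim (\<lambda>k. \<phi> 1 * real (Suc k)) at_top sequentially"
    by (rule filterlim_tendsto_pos_mult_at_top[OF tendsto_const p])
       (rule filterlim_compose[OF filterlim_real_sequentially filterlim_Suc])
  have "\<phi> 1 * real (Suc k) \<le> \<phi> (real (Suc k))" for k
    using orlicz_scale[OF assms(1), of "real (Suc k)" "1 / real (Suc k)"]
    by (simp add: field_simps)
  then show "\<forall>\<^sub>F k in sequentially. \<phi> 1 * real (Suc k) \<le> \<phi> (real (Suc k))" by simp
qed

subsection \<open>The modular as a supremum over injections\<close>

text \<open>The injection \<sigma> decides which entry of \<open>x\<close> meets which weight, so a
  supremum over injections can replace the rearrangement. For fixed \<open>A\<close> and \<sigma>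
  this is a finite sum, where convexity and limits can be treated term by term.\<close>

definition orlicz_sum ::
  "(real \<Rightarrow> real) \<Rightarrow> (nat \<Rightarrow> real) \<Rightarrow> nat set \<Rightarrow> (nat \<Rightarrow> nat) \<Rightarrow> (nat \<Rightarrow> real) \<Rightarrow> real" where
  "orlicz_sum \<phi> w A \<sigma> x = (\<Sum>i\<in>A. \<phi> \<bar>x (\<sigma> i)\<bar> * w i)"

text \<open>A level below \<open>c\<close> is exceeded at all places of \<open>B\<close>, so it does
  not take part in the infimum. The cardinality is \<open>Suc i\<close> because indices start at
  0.\<close>

lemma rearrangement_lower:
  assumes "finite B" "card B = Suc i" "\<And>j. j \<in> B \<Longrightarrow> c \<le> \<bar>x j\<bar>" "0 \<le> c"
  shows "ennreal c \<le> decreasing_rearrangement x i"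
  unfolding decreasing_rearrangement_def
proof (rule INF_greatest)
  fix l assume l: "l \<in> {l. l > 0 \<and> distribution_fun x l < of_nat (Suc i)}"
  show "ennreal c \<le> ennreal l"
  proof (rule ccontr)
    assume "\<not> ennreal c \<le> ennreal l"
    then have "l < c" by (meson ennreal_leI not_le)
    then have "B \<subseteq> {j. \<bar>x j\<bar> > l}" using assms(3) by fastforce
    then have "emeasure (count_space UNIV) B \<le> distribution_fun x l"
      unfolding distribution_fun_def by (intro emeasure_mono) auto
    moreover have "emeasure (count_space UNIV) B = of_nat (Suc i)"
      using assms by (simp add: emeasure_count_space)
    ultimately show False using l by auto
  qed
qed

lemma orlicz_ext_mono:
  assumes "orlicz_function \<phi>" "0 \<le> c" "ennreal c \<le> t"
  shows "ennreal (\<phi> c) \<le> orlicz_ext \<phi> t"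
proof (cases t)
  case (real r)
  then show ?thesis
    using assms by (auto simp: orlicz_ext_def intro!: ennreal_leI orlicz_mono[OF assms(1)])
qed (simp add: orlicz_ext_def)

text \<open>Exchanging the values at the smallest entry and at the largest index of \<open>A\<close> does not
  decrease the sum, since \<open>w\<close> is decreasing.\<close>

lemma orlicz_sum_le_partial:
  assumes \<phi>: "orlicz_function \<phi>" and w: "weight_sequence w"
    and "finite A" "inj_on \<sigma> A"
  shows "ennreal (orlicz_sum \<phi> w A \<sigma> x) \<le>
    (\<Sum>i<card A. orlicz_ext \<phi> (decreasing_rearrangement x i) * ennreal (w i))"
  using assms(3,4)
proof (induction "card A" arbitrary: A \<sigma>)
  case 0
  then show ?case by (simp add: orlicz_sum_def)
next
  case (Suc n)
  have w0: "0 \<le> w i" and wd: "i \<le> j \<Longrightarrow> w j \<le> w i" for i j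
    using w by (auto simp: weight_sequence_def less_imp_le dest: decseqD)
  have ne: "A \<noteq> {}" using Suc by auto
  define b where "b = Max A"
  have b: "b \<in> A" "\<And>i. i \<in> A \<Longrightarrow> i \<le> b"
    unfolding b_def using Suc ne by auto
  obtain a where a: "a \<in> A" "\<And>i. i \<in> A \<Longrightarrow> \<bar>x (\<sigma> a)\<bar> \<le> \<bar>x (\<sigma> i)\<bar>"
    using arg_min_if_finite[OF \<open>finite A\<close> ne, of "\<lambda>i. \<bar>x (\<sigma> i)\<bar>"] by (metis not_le)
  define \<tau> where "\<tau> = \<sigma>(a := \<sigma> b, b := \<sigma> a)"
  define A' where "A' = A - {b}"
  have cA: "card A' = n" "finite A'" using Suc b by (auto simp: A'_def)
  have inj: "inj_on \<tau> A'"
    using Suc.prems b a unfolding A'_def \<tau>_def inj_on_def by auto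
  have IH: "ennreal (orlicz_sum \<phi> w A' \<tau> x) \<le>
    (\<Sum>i<n. orlicz_ext \<phi> (decreasing_rearrangement x i) * ennreal (w i))"
    using Suc.hyps(1)[of A' \<tau>] cA inj by simp
  let ?m = "\<phi> \<bar>x (\<sigma> a)\<bar>"
  have m0: "0 \<le> ?m" by (rule orlicz_nonneg[OF \<phi>]) simp
  have swap: "orlicz_sum \<phi> w A \<sigma> x \<le> orlicz_sum \<phi> w A' \<tau> x + ?m * w b"
  proof (cases "a = b")
    case True
    have "orlicz_sum \<phi> w A' \<tau> x = (\<Sum>i\<in>A'. \<phi> \<bar>x (\<sigma> i)\<bar> * w i)"
      unfolding orlicz_sum_def by (rule sum.cong) (auto simp: A'_def \<tau>_def True)
    then show ?thesis
      using sum.remove[OF \<open>finite A\<close> b(1), of "\<lambda>i. \<phi> \<bar>x (\<sigma> i)\<bar> * w i"] True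
      by (simp add: orlicz_sum_def A'_def)
  next
    case False
    define B where "B = A' - {a}"
    have aA: "a \<in> A'" using a False by (auto simp: A'_def)
    have "orlicz_sum \<phi> w A' \<tau> x = \<phi> \<bar>x (\<sigma> b)\<bar> * w a + (\<Sum>i\<in>B. \<phi> \<bar>x (\<tau> i)\<bar> * w i)"
      using sum.remove[OF cA(2) aA, of "\<lambda>i. \<phi> \<bar>x (\<tau> i)\<bar> * w i"] False
      by (simp add: orlicz_sum_def B_def \<tau>_def)
    also have "(\<Sum>i\<in>B. \<phi> \<bar>x (\<tau> i)\<bar> * w i) = (\<Sum>i\<in>B. \<phi> \<bar>x (\<sigma> i)\<bar> * w i)"
      by (rule sum.cong) (auto simp: A'_def B_def \<tau>_def)
    finally have 1: "orlicz_sum \<phi> w A' \<tau> x = \<phi> \<bar>x (\<sigma> b)\<bar> * w a + (\<Sum>i\<in>B. \<phi> \<bar>x (\<sigma> i)\<bar> * w i)" .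
    have 2: "orlicz_sum \<phi> w A \<sigma> x = \<phi> \<bar>x (\<sigma> b)\<bar> * w b + (?m * w a + (\<Sum>i\<in>B. \<phi> \<bar>x (\<sigma> i)\<bar> * w i))"
      using sum.remove[OF \<open>finite A\<close> b(1), of "\<lambda>i. \<phi> \<bar>x (\<sigma> i)\<bar> * w i"]
        sum.remove[OF cA(2) aA, of "\<lambda>i. \<phi> \<bar>x (\<sigma> i)\<bar> * w i"]
      by (simp add: orlicz_sum_def B_def A'_def)
    \<comment> \<open>The exchange changes the sum by exactly this product of two nonnegative
      factors.\<close>
    have "0 \<le> (\<phi> \<bar>x (\<sigma> b)\<bar> - ?m) * (w a - w b)"
      using orlicz_mono[OF \<phi> _ a(2)[OF b(1)]] wd[OF b(2)[OF a(1)]] by simp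
    then show ?thesis unfolding 1 2 by (simp add: algebra_simps)
  qed
  have "ennreal \<bar>x (\<sigma> a)\<bar> \<le> decreasing_rearrangement x n"
    by (rule rearrangement_lower[of "\<sigma> ` A"]) (use Suc a in \<open>auto simp: card_image\<close>)
  then have ext: "ennreal ?m \<le> orlicz_ext \<phi> (decreasing_rearrangement x n)"
    by (intro orlicz_ext_mono[OF \<phi>]) auto
  \<comment> \<open>Since \<open>A\<close> has \<open>Suc n\<close> elements, its largest index
    \<open>b\<close> is at least \<open>n\<close>, so \<open>w b\<close> may be replaced by
    \<open>w n\<close>.\<close>
  have "A \<subseteq> {..b}" using b by auto
  then have "card A \<le> card {..b}" by (rule card_mono[rotated]) simp
  then have "n \<le> b" using Suc by simp
  then have "ennreal (w b) \<le> ennreal (w n)" using wd by (intro ennreal_leI) auto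
  with ext have last: "ennreal (?m * w b) \<le> orlicz_ext \<phi> (decreasing_rearrangement x n) * ennreal (w n)"
    using m0 w0 by (simp add: ennreal_mult mult_mono)
  have s0: "0 \<le> orlicz_sum \<phi> w A' \<tau> x"
    unfolding orlicz_sum_def by (intro sum_nonneg mult_nonneg_nonneg orlicz_nonneg[OF \<phi>] w0) simp
  have "ennreal (orlicz_sum \<phi> w A \<sigma> x) \<le> ennreal (orlicz_sum \<phi> w A' \<tau> x) + ennreal (?m * w b)"
    using ennreal_leI[OF swap] s0 m0 w0 by (simp add: ennreal_plus)
  also have "\<dots> \<le> (\<Sum>i<Suc n. orlicz_ext \<phi> (decreasing_rearrangement x i) * ennreal (w i))"
    using add_mono[OF IH last] by simp
  finally show ?case using Suc by simp
qed

text \<open>Greedy choice: if \<open>l n\<close> is positive and below the rearrangement, more than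
  \<open>n\<close> entries exceed it, so one of them avoids the \<open>n\<close> places already
  used. Negative levels serve where the rearrangement is 0 and no positive level lies below it;
  every entry exceeds them.\<close>

lemma distinct_values_above:
  assumes "\<And>i. l i < 0 \<or> l i > 0 \<and> ennreal (l i) < decreasing_rearrangement x i"
  shows "\<exists>\<sigma>. inj_on \<sigma> {..<n} \<and> (\<forall>i<n. l i < \<bar>x (\<sigma> i)\<bar>)"
proof (induction n)
  case (Suc n)
  then obtain \<sigma> where \<sigma>: "inj_on \<sigma> {..<n}" "\<forall>i<n. l i < \<bar>x (\<sigma> i)\<bar>" by auto
  let ?S = "{j. \<bar>x j\<bar> > l n}"
  have "\<not> ?S \<subseteq> \<sigma> ` {..<n}"
  proof
    assume sub: "?S \<subseteq> \<sigma> ` {..<n}"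
    show False
    proof (cases "l n < 0")
      case True
      then have "?S = UNIV" by auto
      then show False using sub finite_subset infinite_UNIV_nat by (metis finite_imageI finite_lessThan)
    next
      case False
      then have pos: "l n > 0" and lt: "ennreal (l n) < decreasing_rearrangement x n"
        using assms[of n] by auto
      have "finite ?S" using sub finite_subset by blast
      have "card ?S \<le> card (\<sigma> ` {..<n})" by (rule card_mono[OF _ sub]) simp
      also have "\<dots> \<le> n" using card_image_le[of "{..<n}" \<sigma>] by simp
      finally have "distribution_fun x (l n) < of_nat (Suc n)"
        using \<open>finite ?S\<close> unfolding distribution_fun_def
        by (simp add: emeasure_count_space ennreal_less_iff flip: of_nat_Suc)
      then have "decreasing_rearrangement x n \<le> ennreal (l n)"
        unfolding decreasing_rearrangement_def using pos by (intro INF_lower) simp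
      then show False using lt by simp
    qed
  qed
  then obtain j where j: "\<bar>x j\<bar> > l n" "j \<notin> \<sigma> ` {..<n}" by blast
  have "inj_on (\<sigma>(n := j)) {..<Suc n}"
    using \<sigma>(1) j(2) by (auto simp: inj_on_def lessThan_Suc)
  moreover have "\<forall>i<Suc n. l i < \<bar>x ((\<sigma>(n := j)) i)\<bar>"
    using \<sigma>(2) j(1) by (simp add: less_Suc_eq)
  ultimately show ?case by blast
qed simp

text \<open>Strict lower levels are what \<open>distinct_values_above\<close> can realise by entries
  of a sequence. For \<open>t\<close> = 0 the level is constantly -1, for finite positive
  \<open>t\<close> continuity of \<phi> is used, and for infinite \<open>t\<close> its growth.
  \<open>max 0\<close> undoes the artificial negative level.\<close>

lemma orlicz_ext_approx:
  assumes \<phi>: "orlicz_function \<phi>" "nondegenerate \<phi>"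
  obtains u where "\<And>k. u k < 0 \<or> u k > 0 \<and> ennreal (u k) < t"
    "(\<lambda>k. ennreal (\<phi> (max 0 (u k)))) \<longlonglongrightarrow> orlicz_ext \<phi> t"
proof (cases t)
  case (real r)
  show ?thesis
  proof (cases "r = 0")
    case True
    show ?thesis
      using that[of "\<lambda>_. -1"] real True \<phi> by (simp add: orlicz_ext_def)
  next
    case False
    with real have r: "r > 0" by simp
    \<comment> \<open>With \<open>k + 2\<close> the level is positive already at \<open>k\<close> =
      0.\<close>
    define u where "u k = r * (1 - 1 / real (k + 2))" for k
    have u: "0 < u k" "u k < r" for k
      using r by (auto simp: u_def field_simps intro!: add_pos_nonneg)
    have "u \<longlonglongrightarrow> r * (1 - 0)"
      unfolding u_def
      by (intro tendsto_intros LIMSEQ_ignore_initial_segment[OF lim_1_over_n]) 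
    then have "(\<lambda>k. \<phi> (u k)) \<longlonglongrightarrow> \<phi> r"
      using orlicz_tendsto[OF \<phi>(1)] u by (simp add: less_imp_le)
    then have "(\<lambda>k. ennreal (\<phi> (max 0 (u k)))) \<longlonglongrightarrow> ennreal (\<phi> r)"
      using u by (simp add: max.absorb2 less_imp_le tendsto_ennrealI)
    then show ?thesis
      using that[of u] u real by (simp add: orlicz_ext_def ennreal_less_iff less_imp_le)
  qed
next
  case top
  have "(\<lambda>k. ennreal (\<phi> (real (Suc k)))) \<longlonglongrightarrow> \<infinity>"
    using orlicz_at_top[OF \<phi>] by (simp add: ennreal_tendsto_top_eq_at_top)
  then show ?thesis
    using that[of "\<lambda>k. real (Suc k)"] top by (simp add: orlicz_ext_def less_top[symmetric])
qed

text \<open>The modular is the supremum of the finite sums. For the converse, every partial sum of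
  the series is a limit of sums over levels just below the rearrangement, and those are dominated by
  an \<open>orlicz_sum\<close> along distinct entries exceeding the levels.\<close>

lemma orlicz_lorentz_modular_le_iff:
  assumes \<phi>: "orlicz_function \<phi>" "nondegenerate \<phi>" and w: "weight_sequence w"
  shows "orlicz_lorentz_modular \<phi> w x \<le> c \<longleftrightarrow>
    (\<forall>A \<sigma>. finite A \<longrightarrow> inj_on \<sigma> A \<longrightarrow> ennreal (orlicz_sum \<phi> w A \<sigma> x) \<le> c)"
proof (intro iffI allI impI)
  fix A :: "nat set" and \<sigma> :: "nat \<Rightarrow> nat"
  assume le: "orlicz_lorentz_modular \<phi> w x \<le> c" and A: "finite A" "inj_on \<sigma> A"
  have "ennreal (orlicz_sum \<phi> w A \<sigma> x) \<le>
      (\<Sum>i<card A. orlicz_ext \<phi> (decreasing_rearrangement x i) * ennreal (w i))"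
    by (rule orlicz_sum_le_partial) fact+
  also have "\<dots> \<le> orlicz_lorentz_modular \<phi> w x"
    unfolding orlicz_lorentz_modular_def by (rule sum_le_suminf) auto
  also note le
  finally show "ennreal (orlicz_sum \<phi> w A \<sigma> x) \<le> c" .
next
  assume *: "\<forall>A \<sigma>. finite A \<longrightarrow> inj_on \<sigma> A \<longrightarrow> ennreal (orlicz_sum \<phi> w A \<sigma> x) \<le> c"
  have w0: "0 \<le> w i" for i
    using w by (auto simp: weight_sequence_def less_imp_le)
  have wpos: "ennreal (w i) \<noteq> 0" for i
    using w by (auto simp: weight_sequence_def ennreal_eq_0_iff not_le)
  let ?r = "decreasing_rearrangement x"
  have "\<exists>u. (\<forall>k. u k < 0 \<or> u k > 0 \<and> ennreal (u k) < ?r i) \<and>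
      (\<lambda>k. ennreal (\<phi> (max 0 (u k)))) \<longlonglongrightarrow> orlicz_ext \<phi> (?r i)" for i
    using orlicz_ext_approx[OF \<phi>] by metis
  then obtain u where u: "\<And>i k. u i k < 0 \<or> u i k > 0 \<and> ennreal (u i k) < ?r i"
    and lim: "\<And>i. (\<lambda>k. ennreal (\<phi> (max 0 (u i k)))) \<longlonglongrightarrow> orlicz_ext \<phi> (?r i)"
    by metis
  have "(\<Sum>i<n. orlicz_ext \<phi> (?r i) * ennreal (w i)) \<le> c" for n
  proof (rule LIMSEQ_le_const2)
    show "(\<lambda>k. \<Sum>i<n. ennreal (\<phi> (max 0 (u i k))) * ennreal (w i)) \<longlonglongrightarrow>
        (\<Sum>i<n. orlicz_ext \<phi> (?r i) * ennreal (w i))"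
      \<comment> \<open>The limits may be infinite, and multiplication on \<open>ennreal\<close> is
        discontinuous at infinity times 0; \<open>wpos\<close> rules that case out.\<close>
      by (intro tendsto_sum tendsto_mult_ennreal lim tendsto_const) (auto simp: wpos)
    have "(\<Sum>i<n. ennreal (\<phi> (max 0 (u i k))) * ennreal (w i)) \<le> c" for k
    proof -
      obtain \<sigma> where \<sigma>: "inj_on \<sigma> {..<n}" "\<forall>i<n. u i k < \<bar>x (\<sigma> i)\<bar>"
        using distinct_values_above[of "\<lambda>i. u i k" x n] u by blast
      have "(\<Sum>i<n. ennreal (\<phi> (max 0 (u i k))) * ennreal (w i)) =
          ennreal (\<Sum>i<n. \<phi> (max 0 (u i k)) * w i)"
        using w0 orlicz_nonneg[OF \<phi>(1)]
        by (subst sum_ennreal[symmetric]) (auto intro!: sum.cong simp: ennreal_mult)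
      also have "\<dots> \<le> ennreal (orlicz_sum \<phi> w {..<n} \<sigma> x)"
        unfolding orlicz_sum_def using \<sigma> w0
        by (intro ennreal_leI sum_mono mult_right_mono orlicz_mono[OF \<phi>(1)]) (auto simp: less_imp_le)
      also have "\<dots> \<le> c" using * \<sigma> by simp
      finally show ?thesis .
    qed
    then show "\<exists>N. \<forall>k\<ge>N. (\<Sum>i<n. ennreal (\<phi> (max 0 (u i k))) * ennreal (w i)) \<le> c" by blast
  qed
  then show "orlicz_lorentz_modular \<phi> w x \<le> c"
    unfolding orlicz_lorentz_modular_def by (intro suminf_le_const) auto
qed

subsection \<open>Sequence spaces of convex modulars\<close>

definition head_seq :: "nat \<Rightarrow> (nat \<Rightarrow> real) \<Rightarrow> nat \<Rightarrow> real" where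
  "head_seq m x = (\<lambda>i. if i < m then x i else 0)"

definition tail_seq :: "nat \<Rightarrow> (nat \<Rightarrow> real) \<Rightarrow> nat \<Rightarrow> real" where
  "tail_seq m x = (\<lambda>i. if i < m then 0 else x i)"

definition unit_seq :: "nat \<Rightarrow> nat \<Rightarrow> real" where
  "unit_seq i = (\<lambda>j. if j = i then 1 else 0)"

definition modular_space :: "((nat \<Rightarrow> real) \<Rightarrow> ennreal) \<Rightarrow> (nat \<Rightarrow> real) set" where
  "modular_space \<rho> = {x. \<exists>k>0. \<rho> (k *\<^sub>R x) < \<infinity>}"

definition modular_norm :: "((nat \<Rightarrow> real) \<Rightarrow> ennreal) \<Rightarrow> (nat \<Rightarrow> real) \<Rightarrow> real" where
  "modular_norm \<rho> x = Inf {\<epsilon>. \<epsilon> > 0 \<and> \<rho> (x /\<^sub>R \<epsilon>) \<le> 1}"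

lemma head_plus_tail: "head_seq m x + tail_seq m x = x"
  by (simp add: head_seq_def tail_seq_def fun_eq_iff)

lemma head_seq_Suc: "head_seq (Suc m) x = head_seq m x + x m *\<^sub>R unit_seq m"
  by (auto simp: head_seq_def unit_seq_def fun_eq_iff scaleR_fun_def less_Suc_eq)

lemma head_seq_0: "head_seq 0 x = 0"
  by (simp add: head_seq_def fun_eq_iff)

lemma tail_seq_add: "tail_seq m (x + y) = tail_seq m x + tail_seq m y"
  by (simp add: tail_seq_def fun_eq_iff)

lemma tail_seq_scaleR: "tail_seq m (c *\<^sub>R x) = c *\<^sub>R tail_seq m x"
  by (simp add: tail_seq_def fun_eq_iff scaleR_fun_def)

lemma tail_seq_0: "tail_seq m 0 = 0"
  by (simp add: tail_seq_def fun_eq_iff)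

text \<open>This isolates what the M-ideal argument needs, without weights or rearrangements.
  \<open>modular_Fatou\<close> yields an attained Luxemburg infimum and completeness;
  \<open>modular_disjoint\<close> and \<open>modular_tail\<close> allow a finite piece and a far
  tail to be glued inside the unit ball. \<open>modular_tail\<close> concerns only sequences of
  finite modular and does not force the norms of the tails to 0, so the order-continuous part may be
  proper.\<close>

locale sequence_modular =
  fixes \<rho> :: "(nat \<Rightarrow> real) \<Rightarrow> ennreal"
  assumes modular_zero: "\<rho> 0 = 0"
    and modular_definite: "\<rho> x = 0 \<Longrightarrow> x = 0"
    and modular_mono: "(\<And>i. \<bar>x i\<bar> \<le> \<bar>y i\<bar>) \<Longrightarrow> \<rho> x \<le> \<rho> y"
    and modular_convex: "0 \<le> t \<Longrightarrow> t \<le> 1 \<Longrightarrow>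
      \<rho> ((1 - t) *\<^sub>R x + t *\<^sub>R y) \<le> ennreal (1 - t) * \<rho> x + ennreal t * \<rho> y"
    and modular_Fatou: "(\<And>i. (\<lambda>k. u k i) \<longlonglongrightarrow> x i) \<Longrightarrow> (\<And>k. \<rho> (u k) \<le> c) \<Longrightarrow> \<rho> x \<le> c"
    and modular_disjoint: "(\<And>i. x i = 0 \<or> y i = 0) \<Longrightarrow> \<rho> (x + y) \<le> \<rho> x + \<rho> y"
    and modular_tail: "\<rho> x < \<infinity> \<Longrightarrow> (\<lambda>m. \<rho> (tail_seq m x)) \<longlonglongrightarrow> 0"
    and modular_unit: "\<rho> (unit_seq i) < \<infinity>"
begin

abbreviation X where "X \<equiv> modular_space \<rho>"
abbreviation N where "N \<equiv> modular_norm \<rho>"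

section \<open>The Luxemburg norm of a convex modular\<close>

lemma modular_scale:
  assumes "0 \<le> t" "t \<le> 1"
  shows "\<rho> (t *\<^sub>R x) \<le> ennreal t * \<rho> x"
  using modular_convex[OF assms, of 0 x] by (simp add: modular_zero)

lemma mem_if_le_1: "0 < c \<Longrightarrow> \<rho> (x /\<^sub>R c) \<le> 1 \<Longrightarrow> x \<in> X"
  unfolding modular_space_def
  by (auto intro!: exI[of _ "inverse c"] intro: le_less_trans simp: less_top[symmetric] top_unique)

lemma mem_le_1:
  assumes "x \<in> X"
  obtains e where "e > 0" "\<rho> (x /\<^sub>R e) \<le> 1"
proof -
  obtain k where k: "k > 0" "\<rho> (k *\<^sub>R x) < \<infinity>"
    using assms by (auto simp: modular_space_def)
  then obtain M where M: "\<rho> (k *\<^sub>R x) = ennreal M" "0 \<le> M"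
    by (metis infinity_ennreal_def less_top_ennreal)
  \<comment> \<open>By convexity this factor brings a modular of value \<open>M\<close> down to at
    most \<open>M / (1 + M)\<close>.\<close>
  let ?t = "1 / (1 + M)"
  have t: "0 < ?t" "?t \<le> 1" using M by auto
  have "\<rho> (?t *\<^sub>R (k *\<^sub>R x)) \<le> ennreal ?t * ennreal M"
    using modular_scale[of ?t "k *\<^sub>R x"] t M(1) by simp
  also have "\<dots> = ennreal (M / (1 + M))"
    using t M by (simp flip: ennreal_mult)
  also have "\<dots> \<le> 1" using M by (simp add: field_simps)
  finally show ?thesis
    using that[of "inverse (?t * k)"] t k by simp
qed

lemma modular_scale_mono:
  assumes "0 < a" "a \<le> b"
  shows "\<rho> (x /\<^sub>R b) \<le> \<rho> (x /\<^sub>R a)"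
  using assms by (intro modular_mono)
    (simp add: scaleR_fun_def abs_mult mult_right_mono le_imp_inverse_le)

lemma norm_nonneg: "x \<in> X \<Longrightarrow> 0 \<le> N x"
  unfolding modular_norm_def by (rule cInf_greatest) (use mem_le_1[of x] in \<open>blast, auto\<close>)

text \<open>Every level above \<open>c\<close> is admissible; letting these levels decrease to
  \<open>c\<close>, \<open>modular_Fatou\<close> carries the bound over, so the infimum is attained.
  Later norm estimates thereby become modular estimates.\<close>

lemma norm_le_iff:
  assumes "x \<in> X" "c > 0"
  shows "N x \<le> c \<longleftrightarrow> \<rho> (x /\<^sub>R c) \<le> 1"
proof
  let ?S = "{\<epsilon>. \<epsilon> > 0 \<and> \<rho> (x /\<^sub>R \<epsilon>) \<le> 1}"
  have ne: "?S \<noteq> {}" using mem_le_1[OF assms(1)] by blast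
  have bdd: "bdd_below ?S" by (intro bdd_belowI[of _ 0]) auto
  show "\<rho> (x /\<^sub>R c) \<le> 1 \<Longrightarrow> N x \<le> c"
    unfolding modular_norm_def using assms(2) by (intro cInf_lower bdd) auto
  assume le: "N x \<le> c"
  have *: "\<rho> (x /\<^sub>R e) \<le> 1" if "e > c" for e
  proof -
    have "Inf ?S < e" using le that unfolding modular_norm_def by simp
    then obtain d where "d \<in> ?S" "d < e" using cInf_less_iff[OF ne bdd] by blast
    then show ?thesis using modular_scale_mono[of d e x] by (auto intro: order_trans)
  qed
  show "\<rho> (x /\<^sub>R c) \<le> 1"
  proof (rule modular_Fatou)
    show "\<rho> (x /\<^sub>R (c + inverse (real (Suc k)))) \<le> 1" for k
      by (rule *) simp
    have "(\<lambda>k. inverse (c + inverse (real (Suc k))) * x i) \<longlonglongrightarrow> inverse (c + 0) * x i" for i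
      using assms(2) by (intro tendsto_intros LIMSEQ_inverse_real_of_nat) auto
    then show "(\<lambda>k. (x /\<^sub>R (c + inverse (real (Suc k)))) i) \<longlonglongrightarrow> (x /\<^sub>R c) i" for i
      by (simp add: scaleR_fun_def)
  qed
qed

lemma mem_normI: "c > 0 \<Longrightarrow> \<rho> (x /\<^sub>R c) \<le> 1 \<Longrightarrow> x \<in> X \<and> N x \<le> c"
  using mem_if_le_1 norm_le_iff by blast

lemma mem_mono:
  assumes "y \<in> X" "\<And>i. \<bar>x i\<bar> \<le> \<bar>y i\<bar>"
  shows "x \<in> X" "N x \<le> N y"
proof -
  have le: "\<rho> (x /\<^sub>R e) \<le> \<rho> (y /\<^sub>R e)" if "e > 0" for e
    using that assms(2) by (intro modular_mono) (simp add: scaleR_fun_def abs_mult mult_left_mono)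
  obtain e where "e > 0" "\<rho> (y /\<^sub>R e) \<le> 1" using mem_le_1[OF assms(1)] by blast
  then show x: "x \<in> X" using le[of e] mem_if_le_1[of e x] by (auto intro: order_trans)
  \<comment> \<open>The slack \<open>e\<close> makes the level positive, as
    \<open>norm_le_iff\<close> requires, even if \<open>N y\<close> is 0.\<close>
  have "N x \<le> N y + e" if "e > 0" for e
  proof -
    have p: "0 < N y + e" using norm_nonneg[OF assms(1)] that by simp
    have "\<rho> (y /\<^sub>R (N y + e)) \<le> 1" using norm_le_iff[OF assms(1) p] that by simp
    then show ?thesis using norm_le_iff[OF x p] le[OF p] by (auto intro: order_trans)
  qed
  then show "N x \<le> N y" by (rule field_le_epsilon)
qed

lemma add_mem_norm:
  assumes "x \<in> X" "y \<in> X"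
  shows "x + y \<in> X" "N (x + y) \<le> N x + N y"
proof -
  have *: "x + y \<in> X \<and> N (x + y) \<le> a + b" if "N x \<le> a" "N y \<le> b" "a > 0" "b > 0" for a b
  proof (rule mem_normI)
    \<comment> \<open>With this weight, \<open>x + y\<close> divided by \<open>a + b\<close> is a
      convex combination of \<open>x\<close> divided by \<open>a\<close> and \<open>y\<close>
      divided by \<open>b\<close>.\<close>
    let ?t = "b / (a + b)"
    have t: "0 \<le> ?t" "?t \<le> 1" "1 - ?t = a / (a + b)" using that by (auto simp: field_simps)
    have "(x + y) /\<^sub>R (a + b) = (1 - ?t) *\<^sub>R (x /\<^sub>R a) + ?t *\<^sub>R (y /\<^sub>R b)"
      unfolding t(3)
    proof
      fix i
      have "a / (a + b) * (inverse a * x i) = inverse (a + b) * x i"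
        "b / (a + b) * (inverse b * y i) = inverse (a + b) * y i"
        using that by (auto simp: divide_inverse)
      then show "((x + y) /\<^sub>R (a + b)) i =
          (((a / (a + b)) *\<^sub>R (x /\<^sub>R a) + ?t *\<^sub>R (y /\<^sub>R b))) i"
        by (simp only: scaleR_fun_def plus_fun_apply real_scaleR_def distrib_left)
    qed
    then have "\<rho> ((x + y) /\<^sub>R (a + b)) \<le> ennreal (1 - ?t) * \<rho> (x /\<^sub>R a) + ennreal ?t * \<rho> (y /\<^sub>R b)"
      using modular_convex[OF t(1,2), of "x /\<^sub>R a" "y /\<^sub>R b"] by (simp only:)
    also have "\<dots> \<le> ennreal (1 - ?t) * 1 + ennreal ?t * 1"
      using that norm_le_iff assms by (intro add_mono mult_left_mono) auto
    also have "\<dots> = ennreal ((1 - ?t) + ?t)"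
      using t by (subst ennreal_plus) auto
    finally show "\<rho> ((x + y) /\<^sub>R (a + b)) \<le> 1" by simp
  qed (use that in auto)
  have n: "0 \<le> N x" "0 \<le> N y" using norm_nonneg assms by auto
  show "x + y \<in> X" using *[of "N x + 1" "N y + 1"] n by simp
  have "N (x + y) \<le> N x + N y + e" if "e > 0" for e
    using *[of "N x + e / 2" "N y + e / 2"] n that by simp
  then show "N (x + y) \<le> N x + N y" by (rule field_le_epsilon)
qed

lemma zero_mem_norm: "0 \<in> X" "N 0 = 0"
proof -
  have *: "0 \<in> X \<and> N 0 \<le> c" if "c > 0" for c
    using that by (intro mem_normI) (auto simp: modular_zero)
  then show "0 \<in> X" using zero_less_one by blast
  then have "0 \<le> N 0" by (rule norm_nonneg)
  moreover have "N 0 \<le> 0" by (rule field_le_epsilon) (use * in simp)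
  ultimately show "N 0 = 0" by simp
qed

lemma scaleR_mem_norm:
  assumes "x \<in> X"
  shows "c *\<^sub>R x \<in> X" "N (c *\<^sub>R x) = \<bar>c\<bar> * N x"
proof -
  have *: "c *\<^sub>R x \<in> X \<and> N (c *\<^sub>R x) \<le> \<bar>c\<bar> * N x" if "c \<noteq> 0" "x \<in> X" for c x
  proof -
    have le: "c *\<^sub>R x \<in> X \<and> N (c *\<^sub>R x) \<le> \<bar>c\<bar> * a" if "a > 0" "N x \<le> a" for a
    proof (rule mem_normI)
      have "\<rho> ((c *\<^sub>R x) /\<^sub>R (\<bar>c\<bar> * a)) \<le> \<rho> (x /\<^sub>R a)"
        using \<open>c \<noteq> 0\<close> that
        by (intro modular_mono) (simp add: scaleR_fun_def abs_mult field_simps)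
      also have "\<dots> \<le> 1" using norm_le_iff \<open>x \<in> X\<close> that by blast
      finally show "\<rho> ((c *\<^sub>R x) /\<^sub>R (\<bar>c\<bar> * a)) \<le> 1" .
    qed (use that \<open>c \<noteq> 0\<close> in simp)
    have n: "0 \<le> N x" using norm_nonneg that by auto
    have "N (c *\<^sub>R x) \<le> \<bar>c\<bar> * N x + e" if "e > 0" for e
      using le[of "N x + e / \<bar>c\<bar>"] n that \<open>c \<noteq> 0\<close>
      by (simp add: distrib_left add_nonneg_pos)
    then have "N (c *\<^sub>R x) \<le> \<bar>c\<bar> * N x" by (rule field_le_epsilon)
    then show ?thesis using le[of "N x + 1"] n by simp
  qed
  have "c *\<^sub>R x \<in> X \<and> N (c *\<^sub>R x) = \<bar>c\<bar> * N x"
  proof (cases "c = 0")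
    case False
    \<comment> \<open>The reverse inequality is the first one applied to the scalar
      \<open>inverse c\<close> and the scaled sequence.\<close>
    have "N x \<le> \<bar>inverse c\<bar> * N (c *\<^sub>R x)"
      using *[of "inverse c" "c *\<^sub>R x"] *[of c x] False assms by simp
    then show ?thesis using *[of c x] False assms by (simp add: field_simps)
  qed (simp add: zero_mem_norm)
  then show "c *\<^sub>R x \<in> X" "N (c *\<^sub>R x) = \<bar>c\<bar> * N x" by auto
qed

text \<open>A zero norm bounds the modular of \<open>x\<close> divided by any \<open>e > 0\<close>
  by 1; scaling back by \<open>e \<le> 1\<close> bounds the modular of \<open>x\<close> by
  \<open>e\<close>.\<close>

lemma norm_eq_0D:
  assumes "x \<in> X" "N x = 0"
  shows "x = 0"
proof (rule modular_definite)
  have "\<rho> x \<le> ennreal e" if "0 < e" "e \<le> 1" for e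
  proof -
    have "\<rho> (e *\<^sub>R (x /\<^sub>R e)) \<le> ennreal e * \<rho> (x /\<^sub>R e)"
      using that by (intro modular_scale) auto
    also have "\<dots> \<le> ennreal e * 1"
      using norm_le_iff[OF assms(1), of e] assms(2) that by (intro mult_left_mono) auto
    finally show ?thesis using that by simp
  qed
  then have le: "\<rho> x \<le> ennreal (inverse (real (Suc k)))" for k
    by (simp add: inverse_le_1_iff)
  have "(\<lambda>k. ennreal (inverse (real (Suc k)))) \<longlonglongrightarrow> ennreal 0"
    by (intro tendsto_ennrealI LIMSEQ_inverse_real_of_nat)
  then have "\<rho> x \<le> ennreal 0" by (rule LIMSEQ_le_const) (use le in blast)
  then show "\<rho> x = 0" by simp
qed

lemma subspace_X: "subspace X"
  using zero_mem_norm add_mem_norm scaleR_mem_norm by (simp add: subspace_def)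

lemma diff_mem: "x \<in> X \<Longrightarrow> y \<in> X \<Longrightarrow> x - y \<in> X"
  by (rule subspace_diff[OF subspace_X])

lemma normed_space: "normed_space_on X N"
  unfolding normed_space_on_def
  by (auto simp: subspace_X norm_nonneg norm_eq_0D zero_mem_norm scaleR_mem_norm add_mem_norm)

section \<open>The norm metric and its completeness\<close>

lemma norm_minus_commute: "x \<in> X \<Longrightarrow> y \<in> X \<Longrightarrow> N (x - y) = N (y - x)"
  using scaleR_mem_norm(2)[of "y - x" "-1"] diff_mem by simp

lemma Metric_space_norm_dist: "Metric_space X (norm_dist X N)"
proof
  fix x y z
  show "0 \<le> norm_dist X N x y"
    by (simp add: norm_dist_def norm_nonneg diff_mem)
  show "norm_dist X N x y = norm_dist X N y x"
    by (simp add: norm_dist_def norm_minus_commute)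
  show "x \<in> X \<Longrightarrow> y \<in> X \<Longrightarrow> norm_dist X N x y = 0 \<longleftrightarrow> x = y"
    using norm_eq_0D[of "x - y"] diff_mem[of x y] zero_mem_norm by (auto simp: norm_dist_def)
  show "x \<in> X \<Longrightarrow> y \<in> X \<Longrightarrow> z \<in> X \<Longrightarrow>
      norm_dist X N x z \<le> norm_dist X N x y + norm_dist X N y z"
    using add_mem_norm(2)[of "x - y" "y - z"] diff_mem by (simp add: norm_dist_def)
qed

lemma norm_Fatou:
  assumes "\<And>k. u k \<in> X" "\<And>k. N (u k) \<le> c" "c > 0" "\<And>i. (\<lambda>k. u k i) \<longlonglongrightarrow> x i"
  shows "x \<in> X \<and> N x \<le> c"
proof (rule mem_normI[OF assms(3)], rule modular_Fatou)
  show "\<rho> (u k /\<^sub>R c) \<le> 1" for k using norm_le_iff assms by blast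
  show "(\<lambda>k. (u k /\<^sub>R c) i) \<longlonglongrightarrow> (x /\<^sub>R c) i" for i
    unfolding scaleR_fun_def by (intro tendsto_intros assms)
qed

lemma unit_mem: "unit_seq i \<in> X"
  unfolding modular_space_def using modular_unit[of i] by (auto intro!: exI[of _ 1])

lemma unit_norm_pos: "0 < N (unit_seq i)"
proof -
  have "unit_seq i \<noteq> 0" by (auto simp: unit_seq_def fun_eq_iff)
  then show ?thesis using norm_eq_0D norm_nonneg unit_mem by (metis order_le_less)
qed

text \<open>Coordinates are bounded functionals, so a norm-Cauchy sequence converges
  coordinatewise.\<close>

lemma coordinate_le:
  assumes "x \<in> X"
  shows "\<bar>x i\<bar> * N (unit_seq i) \<le> N x"
proof -
  have "N (x i *\<^sub>R unit_seq i) \<le> N x"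
    by (rule mem_mono[OF assms]) (simp add: scaleR_fun_def unit_seq_def)
  then show ?thesis using scaleR_mem_norm(2)[OF unit_mem] by simp
qed

lemma mcomplete: "Metric_space.mcomplete X (norm_dist X N)"
proof -
  interpret Metric_space X "norm_dist X N" by (rule Metric_space_norm_dist)
  show ?thesis
    unfolding mcomplete_def
  proof (intro allI impI)
    fix u assume u: "MCauchy u"
    then have mem: "u k \<in> X" for k by (auto simp: MCauchy_def)
    have cau: "\<exists>K. \<forall>m\<ge>K. \<forall>n\<ge>K. N (u m - u n) < e" if "e > 0" for e
    proof -
      have "\<exists>K. \<forall>n n'. K \<le> n \<longrightarrow> K \<le> n' \<longrightarrow> norm_dist X N (u n) (u n') < e"
        using u that by (simp add: MCauchy_def)
      then show ?thesis by (simp add: norm_dist_def mem)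
    qed
    have "\<exists>l. (\<lambda>k. u k i) \<longlonglongrightarrow> l" for i
    proof (rule Cauchy_convergent[unfolded convergent_def], rule metric_CauchyI)
      fix e :: real assume "e > 0"
      then obtain K where K: "\<forall>m\<ge>K. \<forall>n\<ge>K. N (u m - u n) < e * N (unit_seq i)"
        using cau[of "e * N (unit_seq i)"] unit_norm_pos[of i] by auto
      have "dist (u m i) (u n i) < e" if "m \<ge> K" "n \<ge> K" for m n
      proof -
        have "\<bar>(u m - u n) i\<bar> * N (unit_seq i) < e * N (unit_seq i)"
          using coordinate_le[OF diff_mem[OF mem mem]] K that by (blast intro: le_less_trans)
        then show ?thesis using unit_norm_pos[of i] by (simp add: dist_real_def)
      qed
      then show "\<exists>K. \<forall>m\<ge>K. \<forall>n\<ge>K. dist (u m i) (u n i) < e" by blast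
    qed
    then obtain x where x: "\<And>i. (\<lambda>k. u k i) \<longlonglongrightarrow> x i" by metis
    have *: "\<exists>K. \<forall>m\<ge>K. u m - x \<in> X \<and> N (u m - x) \<le> e" if "e > 0" for e
    proof -
      obtain K where K: "\<forall>m\<ge>K. \<forall>n\<ge>K. N (u m - u n) < e" using cau[OF \<open>e > 0\<close>] by blast
      have "u m - x \<in> X \<and> N (u m - x) \<le> e" if "m \<ge> K" for m
      \<comment> \<open>The Cauchy bound holds for all differences with index beyond
        \<open>K\<close>; fixing \<open>m\<close> and letting the other index tend to infinity keeps
        it for the coordinatewise limit.\<close>
      proof (rule norm_Fatou[where u = "\<lambda>k. u m - u (k + K)"])
        show "N (u m - u (k + K)) \<le> e" for k using K that by (simp add: less_imp_le)
        show "(\<lambda>k. (u m - u (k + K)) i) \<longlonglongrightarrow> (u m - x) i" for i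
          using LIMSEQ_ignore_initial_segment[OF x[of i], of K] by (auto intro!: tendsto_intros)
      qed (use mem diff_mem \<open>e > 0\<close> in auto)
      then show ?thesis by blast
    qed
    obtain K where "u K - x \<in> X" using *[of 1] by auto
    \<comment> \<open>Here \<open>x\<close> is recovered as \<open>u K\<close> minus the difference
      \<open>u K - x\<close>.\<close>
    then have xX: "x \<in> X" using diff_mem[OF mem[of K]] by fastforce
    have "limitin mtopology u x sequentially"
      unfolding limit_metric_sequentially
    proof (intro conjI allI impI xX)
      fix e :: real assume "e > 0"
      then obtain K where K: "\<forall>m\<ge>K. u m - x \<in> X \<and> N (u m - x) \<le> e / 2" using *[of "e / 2"] by auto
      have "norm_dist X N (u m) x < e" if "m \<ge> K" for m
        using K that \<open>e > 0\<close> mem xX by (auto simp: norm_dist_def intro: le_less_trans)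
      then show "\<exists>K. \<forall>m\<ge>K. u m \<in> X \<and> norm_dist X N (u m) x < e" using mem by blast
    qed
    then show "\<exists>x. limitin mtopology u x sequentially" by blast
  qed
qed

lemma banach_space: "banach_space_on X N"
  by (simp add: banach_space_on_def normed_space mcomplete)

lemma head_mem: "x \<in> X \<Longrightarrow> head_seq m x \<in> X" "x \<in> X \<Longrightarrow> N (head_seq m x) \<le> N x"
  using mem_mono[of x "head_seq m x"] by (simp_all add: head_seq_def)

lemma tail_mem: "x \<in> X \<Longrightarrow> tail_seq m x \<in> X" "x \<in> X \<Longrightarrow> N (tail_seq m x) \<le> N x"
  using mem_mono[of x "tail_seq m x"] by (simp_all add: tail_seq_def)

subsection \<open>The order-continuous part\<close>

text \<open>A head is a finite combination of unit sequences, so its norm is bounded by finitely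
  many coordinates. The sequences \<open>s n\<close> themselves may lie outside
  \<open>X\<close>.\<close>

lemma norm_head_tendsto_0:
  assumes "\<And>i. (\<lambda>n. s n i) \<longlonglongrightarrow> 0"
  shows "(\<lambda>n. N (head_seq m (s n))) \<longlonglongrightarrow> 0"
proof -
  have "head_seq m x \<in> X \<and> N (head_seq m x) \<le> (\<Sum>i<m. \<bar>x i\<bar> * N (unit_seq i))" for x
  proof (induction m)
    case (Suc m)
    have "x m *\<^sub>R unit_seq m \<in> X" by (rule scaleR_mem_norm[OF unit_mem])
    then have "head_seq m x + x m *\<^sub>R unit_seq m \<in> X \<and>
        N (head_seq m x + x m *\<^sub>R unit_seq m) \<le> (\<Sum>i<Suc m. \<bar>x i\<bar> * N (unit_seq i))"
      using Suc add_mem_norm[of "head_seq m x" "x m *\<^sub>R unit_seq m"]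
        scaleR_mem_norm(2)[OF unit_mem, of "x m" m] by simp
    then show ?case by (simp only: head_seq_Suc)
  next
    case 0
    have "0 \<in> X \<and> N 0 \<le> (\<Sum>i<0. \<bar>x i\<bar> * N (unit_seq i))"
      using zero_mem_norm by simp
    then show ?case by (simp only: head_seq_0)
  qed
  then have le: "0 \<le> N (head_seq m (s n))"
    "N (head_seq m (s n)) \<le> (\<Sum>i<m. \<bar>s n i\<bar> * N (unit_seq i))" for n
    using norm_nonneg by auto
  have "(\<lambda>n. \<Sum>i<m. \<bar>s n i\<bar> * N (unit_seq i)) \<longlonglongrightarrow> (\<Sum>i<m. \<bar>0\<bar> * N (unit_seq i))"
    by (intro tendsto_intros assms)
  then have lim: "(\<lambda>n. \<Sum>i<m. \<bar>s n i\<bar> * N (unit_seq i)) \<longlonglongrightarrow> 0" by simp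
  show ?thesis
    by (rule tendsto_sandwich[OF _ _ tendsto_const lim]) (use le in auto)
qed

abbreviation Xa where "Xa \<equiv> order_continuous_part X N"

text \<open>In one direction the absolute tails of \<open>x\<close> are a test sequence decreasing
  to 0. In the other, each \<open>s n\<close> splits into a head, small because only finitely many
  coordinates count, and a tail dominated by the tail of \<open>x\<close>.\<close>

lemma order_continuous_iff:
  "x \<in> Xa \<longleftrightarrow> x \<in> X \<and> (\<lambda>m. N (tail_seq m x)) \<longlonglongrightarrow> 0"
proof (intro iffI conjI)
  assume x: "x \<in> Xa"
  then show xX: "x \<in> X" by (simp add: order_continuous_part_def)
  define s where "s m i = \<bar>tail_seq m x i\<bar>" for m i
  have "\<forall>n i. 0 \<le> s n i \<and> s n i \<le> \<bar>x i\<bar>" by (simp add: s_def tail_seq_def)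
  moreover have "\<forall>i. decseq (\<lambda>n. s n i)"
    by (auto simp: s_def tail_seq_def decseq_def)
  moreover have "(\<lambda>n. s n i) \<longlonglongrightarrow> 0" for i
    by (rule tendsto_eventually)
      (auto simp: s_def tail_seq_def eventually_sequentially intro!: exI[of _ "Suc i"])
  ultimately have "(\<lambda>n. N (s n)) \<longlonglongrightarrow> 0"
    using x by (auto simp: order_continuous_part_def)
  moreover have "N (s n) = N (tail_seq n x)" for n
  proof (rule antisym)
    show "N (s n) \<le> N (tail_seq n x)"
      by (rule mem_mono[OF tail_mem(1)[OF xX]]) (simp add: s_def)
    have "s n \<in> X"
      by (rule mem_mono[OF xX]) (simp add: s_def tail_seq_def)
    then show "N (tail_seq n x) \<le> N (s n)"
      by (rule mem_mono) (simp add: s_def)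
  qed
  ultimately show "(\<lambda>m. N (tail_seq m x)) \<longlonglongrightarrow> 0" by simp
next
  assume x: "x \<in> X \<and> (\<lambda>m. N (tail_seq m x)) \<longlonglongrightarrow> 0"
  have "decseq (\<lambda>n. N (s n)) \<and> (\<lambda>n. N (s n)) \<longlonglongrightarrow> 0"
    if s: "\<forall>n i. 0 \<le> s n i \<and> s n i \<le> \<bar>x i\<bar>"
      "\<forall>i. decseq (\<lambda>n. s n i) \<and> (\<lambda>n. s n i) \<longlonglongrightarrow> 0" for s :: "nat \<Rightarrow> nat \<Rightarrow> real"
  proof
    have sX: "s n \<in> X" for n
      by (rule mem_mono[of x]) (use x s in auto)
    show "decseq (\<lambda>n. N (s n))"
    proof (rule decseq_SucI, rule mem_mono[OF sX])
      show "\<bar>s (Suc n) i\<bar> \<le> \<bar>s n i\<bar>" for n i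
        using s decseq_SucD by fastforce
    qed
    show "(\<lambda>n. N (s n)) \<longlonglongrightarrow> 0"
    proof (rule LIMSEQ_I)
      fix e :: real assume "e > 0"
      then obtain m where m: "\<bar>N (tail_seq m x)\<bar> < e / 2"
        using LIMSEQ_D[of _ 0 "e / 2"] x by fastforce
      obtain n0 where n0: "\<And>n. n \<ge> n0 \<Longrightarrow> \<bar>N (head_seq m (s n))\<bar> < e / 2"
        using LIMSEQ_D[OF norm_head_tendsto_0[of s m], of "e / 2"] s \<open>e > 0\<close> by auto
      have "norm (N (s n) - 0) < e" if "n \<ge> n0" for n
      proof -
        have "N (s n) \<le> N (head_seq m (s n)) + N (tail_seq m (s n))"
          using add_mem_norm(2)[OF head_mem(1)[OF sX] tail_mem(1)[OF sX]]
          by (metis head_plus_tail)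
        moreover have "N (tail_seq m (s n)) \<le> N (tail_seq m x)"
          by (rule mem_mono) (use x s tail_mem in \<open>auto simp: tail_seq_def\<close>)
        ultimately show ?thesis using n0[OF that] m norm_nonneg[OF sX] by simp
      qed
      then show "\<exists>n0. \<forall>n\<ge>n0. norm (N (s n) - 0) < e" by blast
    qed
  qed
  then show "x \<in> Xa" using x unfolding order_continuous_part_def by blast
qed

lemma subspace_order_continuous: "subspace Xa"
  unfolding subspace_def
proof (intro conjI ballI allI)
  show "0 \<in> Xa" by (simp add: order_continuous_iff zero_mem_norm tail_seq_0)
next
  fix x y assume "x \<in> Xa" "y \<in> Xa"
  then have x: "x \<in> X" "(\<lambda>m. N (tail_seq m x)) \<longlonglongrightarrow> 0"
    and y: "y \<in> X" "(\<lambda>m. N (tail_seq m y)) \<longlonglongrightarrow> 0" by (auto simp: order_continuous_iff)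
  have lim: "(\<lambda>m. N (tail_seq m x) + N (tail_seq m y)) \<longlonglongrightarrow> 0"
    using tendsto_add[OF x(2) y(2)] by simp
  have xy: "x + y \<in> X" by (rule add_mem_norm(1)[OF x(1) y(1)])
  have le: "N (tail_seq m (x + y)) \<le> N (tail_seq m x) + N (tail_seq m y)" for m
    unfolding tail_seq_add by (rule add_mem_norm(2)[OF tail_mem(1)[OF x(1)] tail_mem(1)[OF y(1)]])
  have "(\<lambda>m. N (tail_seq m (x + y))) \<longlonglongrightarrow> 0"
    by (rule tendsto_sandwich[OF _ _ tendsto_const lim])
      (use le norm_nonneg[OF tail_mem(1)[OF xy]] in auto)
  with xy show "x + y \<in> Xa" by (simp add: order_continuous_iff)
next
  fix c x assume "x \<in> Xa"
  then show "c *\<^sub>R x \<in> Xa"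
    using tendsto_mult_right_zero[of "\<lambda>m. N (tail_seq m x)" sequentially "\<bar>c\<bar>"]
    by (simp add: order_continuous_iff scaleR_mem_norm tail_mem tail_seq_scaleR)
qed

text \<open>Passing to a tail does not increase the norm, so the tails of a limit stay uniformly
  close to those of an approximating element.\<close>

lemma closed_order_continuous: "closed_subspace_of Xa X N"
proof -
  interpret Metric_space X "norm_dist X N" by (rule Metric_space_norm_dist)
  have "x \<in> Xa" if u: "range u \<subseteq> Xa" and lim: "limitin mtopology u x sequentially" for u x
  proof -
    have xX: "x \<in> X" using lim by (simp add: limit_metric_sequentially)
    have "(\<lambda>m. N (tail_seq m x)) \<longlonglongrightarrow> 0"
    proof (rule LIMSEQ_I)
      fix e :: real assume e: "e > 0"
      then obtain k where k: "u k \<in> X" "norm_dist X N (u k) x < e / 2"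
        using lim unfolding limit_metric_sequentially by (meson half_gt_zero order_refl)
      have "u k \<in> Xa" using u by auto
      then have "(\<lambda>m. N (tail_seq m (u k))) \<longlonglongrightarrow> 0" by (simp add: order_continuous_iff)
      then obtain m0 where m0: "\<And>m. m \<ge> m0 \<Longrightarrow> \<bar>N (tail_seq m (u k))\<bar> < e / 2"
        using LIMSEQ_D[of _ 0 "e / 2"] e by fastforce
      have "norm (N (tail_seq m x) - 0) < e" if "m \<ge> m0" for m
      proof -
        have d: "x - u k \<in> X" using diff_mem xX k by blast
        have "tail_seq m x = tail_seq m (u k) + tail_seq m (x - u k)"
          by (simp flip: tail_seq_add)
        then have "N (tail_seq m x) \<le> N (tail_seq m (u k)) + N (tail_seq m (x - u k))"
          using add_mem_norm(2)[OF tail_mem(1)[OF k(1)] tail_mem(1)[OF d]] by simp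
        moreover have "N (tail_seq m (x - u k)) \<le> N (x - u k)" by (rule tail_mem[OF d])
        moreover have "N (x - u k) < e / 2"
          using k xX norm_minus_commute by (simp add: norm_dist_def)
        ultimately show ?thesis using m0[OF that] norm_nonneg[OF tail_mem(1)[OF xX]] by simp
      qed
      then show "\<exists>m0. \<forall>m\<ge>m0. norm (N (tail_seq m x) - 0) < e" by blast
    qed
    then show ?thesis using xX by (simp add: order_continuous_iff)
  qed
  moreover have "Xa \<subseteq> X" by (auto simp: order_continuous_iff)
  ultimately show ?thesis
    unfolding closed_subspace_of_def metric_closedin_iff_sequentially_closed
    using subspace_order_continuous by blast
qed

subsection \<open>Regular and singular part of a functional\<close>

abbreviation D where "D \<equiv> dual_space X N"
abbreviation DN where "DN \<equiv> dual_norm X N"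

section \<open>Bounded functionals and the dual norm\<close>

lemma dual_memI:
  assumes "\<And>x y. x \<in> X \<Longrightarrow> y \<in> X \<Longrightarrow> F (x + y) = F x + F y"
    and "\<And>c x. x \<in> X \<Longrightarrow> F (c *\<^sub>R x) = c * F x"
    and "\<And>x. x \<in> X \<Longrightarrow> \<bar>F x\<bar> \<le> C * N x"
    and "\<And>x. x \<notin> X \<Longrightarrow> F x = 0"
  shows "F \<in> D"
  using assms unfolding dual_space_def bounded_linear_between_def by (auto intro!: exI[of _ C])

lemma dual_memD:
  assumes "F \<in> D"
  shows "x \<in> X \<Longrightarrow> y \<in> X \<Longrightarrow> F (x + y) = F x + F y"
    and "x \<in> X \<Longrightarrow> F (c *\<^sub>R x) = c * F x"
    and "x \<notin> X \<Longrightarrow> F x = 0"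
  using assms unfolding dual_space_def bounded_linear_between_def by auto

lemma dual_bound:
  assumes "F \<in> D"
  obtains C where "0 \<le> C" "\<And>x. x \<in> X \<Longrightarrow> \<bar>F x\<bar> \<le> C * N x"
proof -
  obtain C where C: "\<forall>x\<in>X. \<bar>F x\<bar> \<le> C * N x"
    using assms unfolding dual_space_def bounded_linear_between_def by auto
  show ?thesis
  proof (rule that)
    \<comment> \<open>The definition of boundedness permits a negative constant; the absolute value
      makes it usable as a monotone factor.\<close>
    show "\<bar>F x\<bar> \<le> \<bar>C\<bar> * N x" if "x \<in> X" for x
      using bspec[OF C that] mult_right_mono[OF abs_ge_self[of C] norm_nonneg[OF that]] by simp
  qed simp
qed

lemma dual_zero: "F \<in> D \<Longrightarrow> F 0 = 0"
  using dual_memD(2)[of F 0 0] zero_mem_norm by simp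

lemma dual_norm_upper:
  assumes "F \<in> D" "x \<in> X" "N x \<le> 1"
  shows "\<bar>F x\<bar> \<le> DN F"
proof -
  obtain C where C: "0 \<le> C" "\<And>x. x \<in> X \<Longrightarrow> \<bar>F x\<bar> \<le> C * N x"
    using dual_bound[OF assms(1)] by blast
  have "\<bar>F y\<bar> \<le> C" if "y \<in> X" "N y \<le> 1" for y
    using C(2)[OF that(1)] mult_left_mono[OF that(2) C(1)] by simp
  then have "bdd_above ((\<lambda>x. \<bar>F x\<bar>) ` {x \<in> X. N x \<le> 1})"
    by (intro bdd_aboveI[of _ C]) auto
  then show ?thesis
    unfolding dual_norm_def using assms by (intro cSUP_upper) auto
qed

lemma dual_norm_least:
  assumes "\<And>x. x \<in> X \<Longrightarrow> N x \<le> 1 \<Longrightarrow> \<bar>F x\<bar> \<le> c"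
  shows "DN F \<le> c"
  unfolding dual_norm_def using assms zero_mem_norm by (intro cSUP_least) auto

lemma dual_norm_nonneg: "F \<in> D \<Longrightarrow> 0 \<le> DN F"
  using dual_norm_upper[of F 0] zero_mem_norm by simp

lemma dual_norm_triangle:
  assumes "F \<in> D" "G \<in> D"
  shows "DN (F + G) \<le> DN F + DN G"
proof (rule dual_norm_least)
  fix x assume "x \<in> X" "N x \<le> 1"
  then have "\<bar>F x\<bar> \<le> DN F" "\<bar>G x\<bar> \<le> DN G" using dual_norm_upper assms by auto
  then show "\<bar>(F + G) x\<bar> \<le> DN F + DN G" by simp
qed

text \<open>The values of \<open>F\<close> on unit sequences act as coefficients: this is the part
  of \<open>F\<close> represented by a sequence. The branch outside \<open>X\<close> follows the
  convention of \<open>dual_space\<close>.\<close>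

definition regular_part :: "((nat \<Rightarrow> real) \<Rightarrow> real) \<Rightarrow> (nat \<Rightarrow> real) \<Rightarrow> real" where
  "regular_part F x = (if x \<in> X then \<Sum>i. x i * F (unit_seq i) else 0)"

lemma dual_head:
  assumes "F \<in> D" "x \<in> X"
  shows "F (head_seq m x) = (\<Sum>i<m. x i * F (unit_seq i))"
proof (induction m)
  case 0
  show ?case by (simp only: head_seq_0 dual_zero[OF assms(1)]) simp
next
  case (Suc m)
  have u: "x m *\<^sub>R unit_seq m \<in> X" by (rule scaleR_mem_norm(1)[OF unit_mem])
  have "F (head_seq (Suc m) x) = F (head_seq m x) + x m * F (unit_seq m)"
    unfolding head_seq_Suc dual_memD(1)[OF assms(1) head_mem(1)[OF assms(2)] u]
      dual_memD(2)[OF assms(1) unit_mem] by simp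
  then show ?case using Suc by simp
qed

lemma summable_regular_part:
  assumes F: "F \<in> D" and x: "x \<in> X"
  shows "summable (\<lambda>i. \<bar>x i * F (unit_seq i)\<bar>)"
proof -
  obtain C where C: "0 \<le> C" "\<And>x. x \<in> X \<Longrightarrow> \<bar>F x\<bar> \<le> C * N x"
    using dual_bound[OF F] by blast
  \<comment> \<open>The signs are chosen to make every term of \<open>F\<close> on a head of
    \<open>z\<close> nonnegative, while the norm does not exceed that of \<open>x\<close>. The bound
    on \<open>F\<close> then controls the sums of absolute values.\<close>
  define z where "z i = sgn (F (unit_seq i)) * \<bar>x i\<bar>" for i
  have z: "z \<in> X" "N z \<le> N x"
    using mem_mono[OF x, of z] by (auto simp: z_def abs_mult abs_sgn_eq)
  have "(\<Sum>i<m. \<bar>x i * F (unit_seq i)\<bar>) \<le> C * N x" for m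
  proof -
    have "(\<Sum>i<m. \<bar>x i * F (unit_seq i)\<bar>) = (\<Sum>i<m. z i * F (unit_seq i))"
      by (rule sum.cong) (auto simp: z_def abs_mult sgn_real_def)
    also have "\<dots> = F (head_seq m z)" by (simp only: dual_head[OF F z(1)])
    also have "\<dots> \<le> C * N (head_seq m z)"
      using C(2)[OF head_mem(1)[OF z(1)], of m] by simp
    also have "\<dots> \<le> C * N x"
      using head_mem(2)[OF z(1), of m] z(2) C(1) by (intro mult_left_mono) auto
    finally show ?thesis .
  qed
  then show ?thesis by (intro summableI_nonneg_bounded[of _ "C * N x"]) auto
qed

lemma regular_part_lim:
  assumes "F \<in> D" "x \<in> X"
  shows "(\<lambda>m. F (head_seq m x)) \<longlonglongrightarrow> regular_part F x"
  using summable_LIMSEQ[OF summable_rabs_cancel[OF summable_regular_part[OF assms]]]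
  by (simp only: dual_head[OF assms] regular_part_def assms(2) if_True)

lemma regular_part_mem:
  assumes F: "F \<in> D"
  shows "regular_part F \<in> D"
proof -
  obtain C where C: "0 \<le> C" "\<And>x. x \<in> X \<Longrightarrow> \<bar>F x\<bar> \<le> C * N x"
    using dual_bound[OF F] by blast
  have s: "summable (\<lambda>i. x i * F (unit_seq i))" if "x \<in> X" for x
    by (rule summable_rabs_cancel[OF summable_regular_part[OF F that]])
  show ?thesis
  proof (rule dual_memI)
    fix x y assume "x \<in> X" "y \<in> X"
    then show "regular_part F (x + y) = regular_part F x + regular_part F y"
      using suminf_add[OF s[of x] s[of y]] add_mem_norm(1)[of x y]
      by (simp add: regular_part_def distrib_right)
  next
    fix c x assume "x \<in> X"
    then show "regular_part F (c *\<^sub>R x) = c * regular_part F x"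
      using suminf_mult[OF s[of x], of c] scaleR_mem_norm(1)[of x c]
      by (simp add: regular_part_def scaleR_fun_def mult.assoc)
  next
    fix x assume x: "x \<in> X"
    have le: "\<bar>F (head_seq m x)\<bar> \<le> C * N x" for m
      using C(2)[OF head_mem(1)[OF x], of m] mult_left_mono[OF head_mem(2)[OF x, of m] C(1)] by linarith
    show "\<bar>regular_part F x\<bar> \<le> C * N x"
      by (rule LIMSEQ_le_const2[OF tendsto_rabs[OF regular_part_lim[OF F x]]]) (use le in auto)
  qed (simp add: regular_part_def)
qed

lemma dual_diff_mem:
  assumes "F \<in> D" "G \<in> D"
  shows "F - G \<in> D"
proof -
  obtain A B where A: "\<And>x. x \<in> X \<Longrightarrow> \<bar>F x\<bar> \<le> A * N x" and B: "\<And>x. x \<in> X \<Longrightarrow> \<bar>G x\<bar> \<le> B * N x"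
    using dual_bound assms by metis
  show ?thesis
  proof (rule dual_memI)
    show "\<bar>(F - G) x\<bar> \<le> (A + B) * N x" if "x \<in> X" for x
      using A[OF that] B[OF that] by (simp add: distrib_right)
  qed (use dual_memD[OF assms(1)] dual_memD[OF assms(2)] in \<open>auto simp: algebra_simps\<close>)
qed

definition singular_part :: "((nat \<Rightarrow> real) \<Rightarrow> real) \<Rightarrow> (nat \<Rightarrow> real) \<Rightarrow> real" where
  "singular_part F = F - regular_part F"

lemma singular_part_mem: "F \<in> D \<Longrightarrow> singular_part F \<in> D"
  unfolding singular_part_def by (rule dual_diff_mem[OF _ regular_part_mem])

lemma regular_part_unit_0:
  assumes "\<And>i. F (unit_seq i) = 0"
  shows "regular_part F = 0"
  by (simp add: fun_eq_iff regular_part_def assms)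

lemma regular_part_head:
  assumes "F \<in> D" "x \<in> X"
  shows "regular_part F (head_seq m x) = F (head_seq m x)"
proof -
  have "(\<Sum>i. head_seq m x i * F (unit_seq i)) = (\<Sum>i<m. head_seq m x i * F (unit_seq i))"
    by (rule suminf_finite) (auto simp: head_seq_def)
  also have "\<dots> = (\<Sum>i<m. x i * F (unit_seq i))"
    by (rule sum.cong) (auto simp: head_seq_def)
  finally show ?thesis
    by (simp only: dual_head[OF assms] regular_part_def head_mem(1)[OF assms(2)] if_True)
qed

text \<open>Regular part and functional agree on heads, so the singular part vanishes there and sees
  only what happens at infinity.\<close>

lemma singular_part_tail:
  assumes "F \<in> D" "x \<in> X"
  shows "singular_part F (tail_seq m x) = singular_part F x"
proof -
  have "singular_part F (head_seq m x) = 0"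
    by (simp add: singular_part_def regular_part_head[OF assms])
  then show ?thesis
    using dual_memD(1)[OF singular_part_mem[OF assms(1)] head_mem(1)[OF assms(2)] tail_mem(1)[OF assms(2)], of m m]
    by (simp only: head_plus_tail add_0)
qed

lemma singular_part_annihilates:
  assumes F: "F \<in> D" and x: "x \<in> Xa"
  shows "singular_part F x = 0"
proof -
  have x: "x \<in> X" "(\<lambda>m. N (tail_seq m x)) \<longlonglongrightarrow> 0" using x by (auto simp: order_continuous_iff)
  obtain C where C: "0 \<le> C" "\<And>x. x \<in> X \<Longrightarrow> \<bar>singular_part F x\<bar> \<le> C * N x"
    using dual_bound[OF singular_part_mem[OF F]] by blast
  have "\<bar>singular_part F x\<bar> \<le> C * N (tail_seq m x)" for m
    using C(2)[OF tail_mem(1)[OF x(1)], of m] by (simp only: singular_part_tail[OF F x(1)])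
  moreover have "(\<lambda>m. C * N (tail_seq m x)) \<longlonglongrightarrow> 0"
    using tendsto_mult_right_zero[OF x(2)] by simp
  ultimately have "\<bar>singular_part F x\<bar> \<le> 0" by (intro LIMSEQ_le_const) auto
  then show ?thesis by simp
qed

lemma unit_mem_Xa: "unit_seq i \<in> Xa"
proof -
  have "tail_seq m (unit_seq i) = 0" if "m > i" for m
    using that by (auto simp: tail_seq_def unit_seq_def fun_eq_iff)
  then have "\<forall>\<^sub>F m in sequentially. N (tail_seq m (unit_seq i)) = 0"
    using zero_mem_norm(2) by (auto simp: eventually_sequentially intro!: exI[of _ "Suc i"])
  then show ?thesis by (simp add: order_continuous_iff unit_mem tendsto_eventually)
qed

text \<open>Unit sequences are order continuous, so a functional in the annihilator has zero
  coefficients and no regular part. Conversely, singular parts are bounded by the norms of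
  arbitrarily far tails, which tend to 0 on \<open>Xa\<close>.\<close>

lemma annihilator_iff: "F \<in> annihilator X N Xa \<longleftrightarrow> F \<in> D \<and> singular_part F = F"
proof
  assume F: "F \<in> annihilator X N Xa"
  then have "regular_part F = 0"
    by (intro regular_part_unit_0) (simp add: annihilator_def unit_mem_Xa)
  then show "F \<in> D \<and> singular_part F = F"
    using F by (simp add: annihilator_def singular_part_def)
next
  assume F: "F \<in> D \<and> singular_part F = F"
  then show "F \<in> annihilator X N Xa"
    using singular_part_annihilates[of F] by (simp add: annihilator_def)
qed

lemma singular_part_idem:
  assumes "F \<in> D"
  shows "singular_part (singular_part F) = singular_part F"
proof -
  have "singular_part F \<in> annihilator X N Xa"
    using singular_part_mem[OF assms] singular_part_annihilates[OF assms] by (simp add: annihilator_def)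
  then show ?thesis by (simp add: annihilator_iff)
qed

text \<open>Far enough out, a tail of \<open>y\<close> is disjoint from the finitely supported \<open>head_seq n (t x)\<close> and
  so small in modular that the sum of the two stays in the unit ball.\<close>

lemma eventually_norm_head_plus_tail_le_1:
  assumes x: "x \<in> X" "N x \<le> 1" and y: "y \<in> X" "N y \<le> 1" and t: "0 \<le> t" "t < 1"
  shows "\<forall>\<^sub>F m in sequentially. N (head_seq n (t *\<^sub>R x) + tail_seq m y) \<le> 1"
proof -
  have \<rho>: "\<rho> x \<le> 1" "\<rho> y \<le> 1" using norm_le_iff[of _ 1] x y by auto
  have "\<rho> (t *\<^sub>R x) \<le> ennreal t * \<rho> x" using t by (intro modular_scale) auto
  also have "\<dots> \<le> ennreal t * 1" by (intro mult_left_mono \<rho>) simp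
  finally have "\<rho> (t *\<^sub>R x) \<le> ennreal t" by simp
  moreover have "\<rho> (head_seq n (t *\<^sub>R x)) \<le> \<rho> (t *\<^sub>R x)"
    by (rule modular_mono) (simp add: head_seq_def)
  ultimately have \<rho>x: "\<rho> (head_seq n (t *\<^sub>R x)) \<le> ennreal t" by (rule order_trans[rotated])
  have "(\<lambda>m. \<rho> (tail_seq m y)) \<longlonglongrightarrow> 0"
    using \<rho>(2) by (intro modular_tail) (auto intro: le_less_trans simp: less_top[symmetric] top_unique)
  then have "\<forall>\<^sub>F m in sequentially. \<rho> (tail_seq m y) < ennreal (1 - t)"
    by (rule order_tendstoD) (use t in simp)
  with eventually_ge_at_top[of n] show ?thesis
  proof eventually_elim
    case (elim m)
    have "\<rho> (head_seq n (t *\<^sub>R x) + tail_seq m y) \<le> \<rho> (head_seq n (t *\<^sub>R x)) + \<rho> (tail_seq m y)"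
      by (rule modular_disjoint) (use elim in \<open>auto simp: head_seq_def tail_seq_def\<close>)
    also have "\<dots> \<le> ennreal t + ennreal (1 - t)"
      using \<rho>x elim by (intro add_mono) auto
    also have "\<dots> = 1" using t by (simp flip: ennreal_plus)
    finally show ?case using mem_normI[of 1] by simp
  qed
qed

text \<open>The two parts are tested on different vectors \<open>x\<close> and \<open>y\<close>, yet
  one evaluation of \<open>F\<close> bounds both. The limits are taken in the order
  \<open>m\<close>, \<open>n\<close>, \<open>t\<close>, because how far out the tail must start
  depends on \<open>n\<close> and \<open>t\<close>.\<close>

lemma regular_singular_le:
  assumes F: "F \<in> D" and x: "x \<in> X" "N x \<le> 1" and y: "y \<in> X" "N y \<le> 1"
  shows "regular_part F x + singular_part F y \<le> DN F"
proof -
  note R = regular_part_mem[OF F]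
  have 1: "regular_part F (head_seq n (t *\<^sub>R x)) + singular_part F y \<le> DN F"
    if t: "0 \<le> t" "t < 1" for t n
  proof (rule LIMSEQ_le_const2)
    have tx: "t *\<^sub>R x \<in> X" by (rule scaleR_mem_norm(1)[OF x(1)])
    \<comment> \<open>The regular part of a tail is the remainder of a convergent series, so only
      the singular part of \<open>y\<close> survives as \<open>m\<close> grows.\<close>
    have "regular_part F (tail_seq m y) = regular_part F y - F (head_seq m y)" for m
      using dual_memD(1)[OF R head_mem(1)[OF y(1)] tail_mem(1)[OF y(1)], of m m]
        regular_part_head[OF F y(1), of m] by (simp only: head_plus_tail)
    moreover have "(\<lambda>m. regular_part F y - F (head_seq m y)) \<longlonglongrightarrow> regular_part F y - regular_part F y"
      by (intro tendsto_intros regular_part_lim F y)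
    ultimately have lim: "(\<lambda>m. regular_part F (tail_seq m y)) \<longlonglongrightarrow> 0" by simp
    show "(\<lambda>m. regular_part F (head_seq n (t *\<^sub>R x)) + (regular_part F (tail_seq m y) + singular_part F y))
        \<longlonglongrightarrow> regular_part F (head_seq n (t *\<^sub>R x)) + singular_part F y"
      using tendsto_add[OF tendsto_const tendsto_add[OF lim tendsto_const]] by simp
    have "regular_part F (head_seq n (t *\<^sub>R x)) + (regular_part F (tail_seq m y) + singular_part F y) \<le> DN F"
      if "N (head_seq n (t *\<^sub>R x) + tail_seq m y) \<le> 1" for m
    proof -
      have h: "head_seq n (t *\<^sub>R x) \<in> X" and ta: "tail_seq m y \<in> X"
        using head_mem tail_mem tx y by auto
      have "F (head_seq n (t *\<^sub>R x) + tail_seq m y) \<le> DN F"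
        using dual_norm_upper[OF F add_mem_norm(1)[OF h ta] that] by simp
      also have "F (head_seq n (t *\<^sub>R x) + tail_seq m y) = F (head_seq n (t *\<^sub>R x)) + F (tail_seq m y)"
        by (rule dual_memD(1)[OF F h ta])
      also have "F (head_seq n (t *\<^sub>R x)) = regular_part F (head_seq n (t *\<^sub>R x))"
        by (rule regular_part_head[OF F tx, symmetric])
      also have "F (tail_seq m y) = regular_part F (tail_seq m y) + singular_part F (tail_seq m y)"
        by (simp add: singular_part_def)
      finally show ?thesis by (simp only: singular_part_tail[OF F y(1)])
    qed
    then show "\<exists>M. \<forall>m\<ge>M. regular_part F (head_seq n (t *\<^sub>R x)) +
        (regular_part F (tail_seq m y) + singular_part F y) \<le> DN F"
      using eventually_norm_head_plus_tail_le_1[OF x y t, of n]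
      unfolding eventually_sequentially by blast
  qed
  have 2: "t * regular_part F x + singular_part F y \<le> DN F" if t: "0 \<le> t" "t < 1" for t
  proof (rule LIMSEQ_le_const2)
    have tx: "t *\<^sub>R x \<in> X" by (rule scaleR_mem_norm(1)[OF x(1)])
    have "(\<lambda>n. F (head_seq n (t *\<^sub>R x)) + singular_part F y) \<longlonglongrightarrow> regular_part F (t *\<^sub>R x) + singular_part F y"
      by (intro tendsto_intros regular_part_lim F tx)
    then show "(\<lambda>n. F (head_seq n (t *\<^sub>R x)) + singular_part F y) \<longlonglongrightarrow> t * regular_part F x + singular_part F y"
      by (simp only: dual_memD(2)[OF R x(1)])
    show "\<exists>M. \<forall>n\<ge>M. F (head_seq n (t *\<^sub>R x)) + singular_part F y \<le> DN F"
      using 1[OF t] by (simp only: regular_part_head[OF F tx]) simp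
  qed
  \<comment> \<open>Finally \<open>t\<close> tends to 1 from below through values that start at
    0.\<close>
  have "(\<lambda>k. (1 - inverse (real (Suc k))) * regular_part F x + singular_part F y)
      \<longlonglongrightarrow> (1 - 0) * regular_part F x + singular_part F y"
    by (intro tendsto_intros LIMSEQ_inverse_real_of_nat)
  moreover have "(1 - inverse (real (Suc k))) * regular_part F x + singular_part F y \<le> DN F" for k
    by (rule 2) (simp_all add: inverse_le_1_iff)
  ultimately show ?thesis
    using LIMSEQ_le_const2[of _ "(1 - 0) * regular_part F x + singular_part F y" "DN F"] by simp
qed

text \<open>The triangle inequality gives one direction. For the other, \<open>x\<close> and
  \<open>y\<close> in \<open>regular_singular_le\<close> are independent, so the suprema can be
  taken separately.\<close>

lemma dual_norm_decomposition:
  assumes F: "F \<in> D"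
  shows "DN F = DN (singular_part F) + DN (F - singular_part F)"
proof (rule antisym)
  have S: "singular_part F \<in> D" and R: "regular_part F \<in> D"
    using singular_part_mem regular_part_mem F by auto
  have eq: "F - singular_part F = regular_part F" by (simp add: singular_part_def)
  show "DN F \<le> DN (singular_part F) + DN (F - singular_part F)"
    using dual_norm_triangle[OF S R] unfolding eq by (simp add: singular_part_def)
  have abs: "\<bar>regular_part F x\<bar> + \<bar>singular_part F y\<bar> \<le> DN F"
    if x: "x \<in> X" "N x \<le> 1" and y: "y \<in> X" "N y \<le> 1" for x y
  proof -
    \<comment> \<open>The unit ball is symmetric, so a sign change turns values into absolute
      values.\<close>
    have sgn: "\<exists>x'. x' \<in> X \<and> N x' \<le> 1 \<and> G x' = \<bar>G x\<bar>" if "x \<in> X" "N x \<le> 1" "G \<in> D" for G x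
    proof (cases "G x \<ge> 0")
      case False
      then show ?thesis
        using scaleR_mem_norm[OF that(1), of "-1"] dual_memD(2)[OF that(3,1), of "-1"] that
        by (intro exI[of _ "-1 *\<^sub>R x"]) simp
    qed (use that in auto)
    obtain x' where "x' \<in> X" "N x' \<le> 1" "regular_part F x' = \<bar>regular_part F x\<bar>"
      using sgn[OF x R] by blast
    moreover obtain y' where "y' \<in> X" "N y' \<le> 1" "singular_part F y' = \<bar>singular_part F y\<bar>"
      using sgn[OF y S] by blast
    ultimately show ?thesis using regular_singular_le[OF F, of x' y'] by simp
  qed
  have "DN (singular_part F) \<le> DN F - DN (regular_part F)"
  proof (rule dual_norm_least)
    fix y assume y: "y \<in> X" "N y \<le> 1"
    have "DN (regular_part F) \<le> DN F - \<bar>singular_part F y\<bar>"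
    proof (rule dual_norm_least)
      fix x assume "x \<in> X" "N x \<le> 1"
      then show "\<bar>regular_part F x\<bar> \<le> DN F - \<bar>singular_part F y\<bar>" using abs[of x y] y by simp
    qed
    then show "\<bar>singular_part F y\<bar> \<le> DN F - DN (regular_part F)" by simp
  qed
  then show "DN (singular_part F) + DN (F - singular_part F) \<le> DN F" unfolding eq by simp
qed

lemma bounded_linear_singular_part: "bounded_linear_between D DN D DN singular_part"
  unfolding bounded_linear_between_def
proof (intro conjI ballI allI)
  show "singular_part ` D \<subseteq> D" using singular_part_mem by blast
next
  fix F G assume F: "F \<in> D" and G: "G \<in> D"
  have "regular_part (F + G) x = regular_part F x + regular_part G x" for x
  proof (cases "x \<in> X")
    case True
    then show ?thesis
      using suminf_add[OF summable_rabs_cancel[OF summable_regular_part[OF F True]]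
          summable_rabs_cancel[OF summable_regular_part[OF G True]]]
      by (simp add: regular_part_def distrib_left)
  qed (simp add: regular_part_def)
  then show "singular_part (F + G) = singular_part F + singular_part G"
    by (simp add: singular_part_def fun_eq_iff)
next
  fix c F assume F: "F \<in> D"
  have "regular_part (c *\<^sub>R F) x = c * regular_part F x" for x
  proof (cases "x \<in> X")
    case True
    then show ?thesis
      using suminf_mult[OF summable_rabs_cancel[OF summable_regular_part[OF F True]], of c]
      by (simp add: regular_part_def scaleR_fun_def mult.left_commute)
  qed (simp add: regular_part_def)
  then show "singular_part (c *\<^sub>R F) = c *\<^sub>R singular_part F"
    by (simp add: singular_part_def fun_eq_iff scaleR_fun_def right_diff_distrib)
next
  \<comment> \<open>The norm identity itself shows that the projection is a contraction.\<close>
  have "DN (singular_part F) \<le> 1 * DN F" if F: "F \<in> D" for F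
    using dual_norm_decomposition[OF F]
      dual_norm_nonneg[OF dual_diff_mem[OF F singular_part_mem[OF F]]] by simp
  then show "\<exists>C. \<forall>F\<in>D. DN (singular_part F) \<le> C * DN F" by blast
qed

lemma M_ideal_order_continuous_part: "M_ideal Xa X N"
  unfolding M_ideal_def
proof (intro conjI banach_space closed_order_continuous exI[of _ singular_part])
  show "bounded_linear_between D DN D DN singular_part" by (rule bounded_linear_singular_part)
  show "\<forall>F\<in>D. singular_part (singular_part F) = singular_part F"
    using singular_part_idem by blast
  show "\<forall>F\<in>D. DN F = DN (singular_part F) + DN (F - singular_part F)"
    using dual_norm_decomposition by blast
  show "singular_part ` D = annihilator X N Xa"
  proof
    show "singular_part ` D \<subseteq> annihilator X N Xa"
      by (auto simp: annihilator_iff singular_part_mem singular_part_idem)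
    show "annihilator X N Xa \<subseteq> singular_part ` D"
    proof
      fix F assume "F \<in> annihilator X N Xa"
      then have "F \<in> D" "F = singular_part F" by (simp_all add: annihilator_iff)
      then show "F \<in> singular_part ` D" by blast
    qed
  qed
qed

end

subsection \<open>The Orlicz-Lorentz modular\<close>

lemma orlicz_sum_nonneg:
  "orlicz_function \<phi> \<Longrightarrow> weight_sequence w \<Longrightarrow> 0 \<le> orlicz_sum \<phi> w A \<sigma> x"
  unfolding orlicz_sum_def weight_sequence_def
  by (intro sum_nonneg mult_nonneg_nonneg) (auto simp: orlicz_nonneg less_imp_le)

lemma orlicz_sum_le_modular:
  assumes "orlicz_function \<phi>" "nondegenerate \<phi>" "weight_sequence w" "finite A" "inj_on \<sigma> A"
  shows "ennreal (orlicz_sum \<phi> w A \<sigma> x) \<le> orlicz_lorentz_modular \<phi> w x"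
  using orlicz_lorentz_modular_le_iff[OF assms(1-3), of x "orlicz_lorentz_modular \<phi> w x"] assms(4,5)
  by blast

text \<open>Otherwise infinitely many entries are at least some \<open>d > 0\<close> in absolute
  value. Enumerating them pairs each weight with a large entry, so a finite modular would make
  \<open>w\<close> summable.\<close>

lemma orlicz_modular_finite_imp_tendsto_0:
  assumes \<phi>: "orlicz_function \<phi>" "nondegenerate \<phi>" and w: "weight_sequence w"
    and fin: "orlicz_lorentz_modular \<phi> w x < \<infinity>"
  shows "x \<longlonglongrightarrow> 0"
proof (rule ccontr)
  assume "\<not> x \<longlonglongrightarrow> 0"
  then obtain d where d: "d > 0" "\<And>n. \<exists>m\<ge>n. d \<le> \<bar>x m\<bar>"
    by (auto simp: LIMSEQ_iff not_less)
  then have inf: "infinite {m. d \<le> \<bar>x m\<bar>}" by (auto simp: infinite_nat_iff_unbounded_le)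
  define \<sigma> where "\<sigma> = enumerate {m. d \<le> \<bar>x m\<bar>}"
  have \<sigma>: "d \<le> \<bar>x (\<sigma> i)\<bar>" for i
    using enumerate_in_set[OF inf] by (simp add: \<sigma>_def)
  have inj: "inj_on \<sigma> A" for A
    using strict_mono_enumerate[OF inf] strict_mono_imp_inj_on inj_on_subset unfolding \<sigma>_def by blast
  obtain M where M: "orlicz_lorentz_modular \<phi> w x = ennreal M" "0 \<le> M"
    using fin by (metis infinity_ennreal_def less_top_ennreal)
  have pd: "\<phi> d > 0" using \<phi>(2) d(1) by (simp add: nondegenerate_def)
  have w0: "0 \<le> w i" for i using w by (simp add: weight_sequence_def less_imp_le)
  have "sum w {..<n} \<le> M / \<phi> d" for n
  proof -
    have "ennreal (orlicz_sum \<phi> w {..<n} \<sigma> x) \<le> ennreal M"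
      using orlicz_sum_le_modular[OF \<phi> w _ inj, of "{..<n}" x] by (simp add: M(1))
    then have "orlicz_sum \<phi> w {..<n} \<sigma> x \<le> M" using M(2) by simp
    moreover have "\<phi> d * sum w {..<n} \<le> orlicz_sum \<phi> w {..<n} \<sigma> x"
      unfolding orlicz_sum_def sum_distrib_left
      using \<sigma> d w0 by (intro sum_mono mult_right_mono orlicz_mono[OF \<phi>(1)]) auto
    ultimately show ?thesis using pd by (simp add: field_simps)
  qed
  then have "summable w" using w0 by (intro summableI_nonneg_bounded) auto
  then show False using w by (simp add: weight_sequence_def)
qed

text \<open>An injection nearly attaining the modular uses the first \<open>n\<close> weights and finitely many
  entries of \<open>x\<close>. Along a far tail, the first \<open>n\<close> weights see only small entries, and the later
  weights see entries that could be added to that injection.\<close>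

lemma orlicz_modular_tail:
  assumes \<phi>: "orlicz_function \<phi>" "nondegenerate \<phi>" and w: "weight_sequence w"
    and fin: "orlicz_lorentz_modular \<phi> w x < \<infinity>"
  shows "(\<lambda>m. orlicz_lorentz_modular \<phi> w (tail_seq m x)) \<longlonglongrightarrow> 0"
proof -
  have w0: "0 \<le> w i" and wle: "w i \<le> w 0" for i
    using w by (auto simp: weight_sequence_def less_imp_le decseqD)
  have wpos: "w 0 > 0" using w by (simp add: weight_sequence_def)
  note nonneg = orlicz_sum_nonneg[OF \<phi>(1) w]
  obtain M where M: "orlicz_lorentz_modular \<phi> w x = ennreal M" "0 \<le> M"
    using fin by (metis infinity_ennreal_def less_top_ennreal)
  have le_M: "orlicz_sum \<phi> w A \<sigma> x \<le> M" if "finite A" "inj_on \<sigma> A" for A \<sigma>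
    using orlicz_sum_le_modular[OF \<phi> w that, of x] M by simp
  have small: "\<forall>\<^sub>F m in sequentially. orlicz_lorentz_modular \<phi> w (tail_seq m x) \<le> ennreal (2 * e)"
    if e: "e > 0" for e
  proof -
    have "\<exists>A \<sigma>. finite A \<and> inj_on \<sigma> A \<and> M \<le> orlicz_sum \<phi> w A \<sigma> x + e"
    proof (rule ccontr)
      assume *: "\<not> ?thesis"
      have lt: "orlicz_sum \<phi> w A \<sigma> x \<le> M - e" if "finite A" "inj_on \<sigma> A" for A \<sigma>
        using * that by (meson linear le_diff_eq)
      \<comment> \<open>The empty sum gives this. It matters because \<open>ennreal\<close>
        truncates negative reals to 0.\<close>
      have "e \<le> M" using lt[of "{}" id] by (simp add: orlicz_sum_def)
      have "orlicz_lorentz_modular \<phi> w x \<le> ennreal (M - e)"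
        unfolding orlicz_lorentz_modular_le_iff[OF \<phi> w] using lt by (auto intro: ennreal_leI)
      then show False using e \<open>e \<le> M\<close> by (simp add: M(1))
    qed
    then obtain A \<sigma> where A: "finite A" "inj_on \<sigma> A" "M \<le> orlicz_sum \<phi> w A \<sigma> x + e" by blast
    obtain n where n: "A \<subseteq> {..<n}" using finite_nat_bounded[OF A(1)] by blast
    obtain m0 where m0: "\<sigma> ` A \<subseteq> {..<m0}" using finite_nat_bounded A(1) by blast
    \<comment> \<open>The budget \<open>e\<close> is shared among at most \<open>n\<close> early
      weights, each at most \<open>w 0\<close>; \<open>Suc n\<close> avoids division by 0.\<close>
    have "0 < e / (real (Suc n) * w 0)" using e wpos by simp
    then obtain d where d: "d > 0" "\<phi> d < e / (real (Suc n) * w 0)"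
      using orlicz_small[OF \<phi>(1)] by blast
    obtain m1 where m1: "\<And>j. j \<ge> m1 \<Longrightarrow> \<bar>x j\<bar> < d"
      using LIMSEQ_D[OF orlicz_modular_finite_imp_tendsto_0[OF \<phi> w fin] d(1)] by auto
    have "orlicz_sum \<phi> w B \<tau> (tail_seq m x) \<le> 2 * e"
      if m: "m \<ge> max m0 m1" and B: "finite B" "inj_on \<tau> B" for m B \<tau>
    proof -
      let ?f = "\<lambda>i. \<phi> \<bar>tail_seq m x (\<tau> i)\<bar> * w i"
      \<comment> \<open>These are the places with late weights at which the tail can be
        nonzero.\<close>
      define C where "C = {i \<in> B. n \<le> i \<and> m \<le> \<tau> i}"
      have "orlicz_sum \<phi> w B \<tau> (tail_seq m x) = sum ?f (B \<inter> {..<n}) + sum ?f (B - {..<n})"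
        unfolding orlicz_sum_def by (rule sum.Int_Diff[OF B(1)])
      moreover have "sum ?f (B \<inter> {..<n}) \<le> e"
      proof -
        have "sum ?f (B \<inter> {..<n}) \<le> (\<Sum>i\<in>B \<inter> {..<n}. \<phi> d * w 0)"
        proof (intro sum_mono mult_mono orlicz_mono[OF \<phi>(1)] wle w0 orlicz_nonneg[OF \<phi>(1)])
          show "\<bar>tail_seq m x (\<tau> i)\<bar> \<le> d" for i
            using m1[of "\<tau> i"] m d by (auto simp: tail_seq_def not_less less_imp_le)
        qed (use d in auto)
        also have "\<dots> = real (card (B \<inter> {..<n})) * (\<phi> d * w 0)" by simp
        also have "\<dots> \<le> real (Suc n) * (\<phi> d * w 0)"
        proof (rule mult_right_mono)
          have "card (B \<inter> {..<n}) \<le> card {..<n}" by (rule card_mono) auto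
          then show "real (card (B \<inter> {..<n})) \<le> real (Suc n)" by simp
          show "0 \<le> \<phi> d * w 0" using orlicz_nonneg[OF \<phi>(1), of d] d wpos by simp
        qed
        also have "\<dots> = \<phi> d * (real (Suc n) * w 0)" by (simp only: ac_simps)
        also have "\<dots> \<le> e"
          using d(2) wpos by (subst (asm) pos_less_divide_eq) (auto intro: less_imp_le)
        finally show ?thesis .
      qed
      moreover have "sum ?f (B - {..<n}) \<le> e"
      proof -
        \<comment> \<open>The bound \<open>n\<close> separates the weight indices \<open>A\<close>
          and \<open>C\<close>, and \<open>m \<ge> m0\<close> separates the entries they use, so the
          glued map is injective. Its total is at most \<open>M\<close> and the \<sigma> part is at
          least \<open>M - e\<close>, which leaves at most \<open>e\<close> for \<tau>.\<close>
        let ?\<upsilon> = "\<lambda>i. if i \<in> A then \<sigma> i else \<tau> i"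
        have fC: "finite C" and disj: "A \<inter> C = {}" using B n by (auto simp: C_def)
        have "sum ?f (B - {..<n}) = sum ?f C"
          using B orlicz_zero[OF \<phi>(1)]
          by (intro sum.mono_neutral_right) (auto simp: C_def tail_seq_def not_less)
        also have "\<dots> = orlicz_sum \<phi> w C \<tau> x"
          unfolding orlicz_sum_def by (rule sum.cong) (auto simp: C_def tail_seq_def)
        finally have 1: "sum ?f (B - {..<n}) = orlicz_sum \<phi> w C \<tau> x" .
        have "orlicz_sum \<phi> w (A \<union> C) ?\<upsilon> x = orlicz_sum \<phi> w A ?\<upsilon> x + orlicz_sum \<phi> w C ?\<upsilon> x"
          unfolding orlicz_sum_def by (rule sum.union_disjoint[OF A(1) fC disj])
        also have "orlicz_sum \<phi> w A ?\<upsilon> x = orlicz_sum \<phi> w A \<sigma> x"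
          unfolding orlicz_sum_def by (rule sum.cong) auto
        also have "orlicz_sum \<phi> w C ?\<upsilon> x = orlicz_sum \<phi> w C \<tau> x"
          unfolding orlicz_sum_def by (rule sum.cong) (use disj in auto)
        finally have 2: "orlicz_sum \<phi> w (A \<union> C) ?\<upsilon> x = orlicz_sum \<phi> w A \<sigma> x + orlicz_sum \<phi> w C \<tau> x" .
        have \<sigma>m: "\<sigma> i < m" if "i \<in> A" for i using m0 m that by auto
        have "inj_on ?\<upsilon> (A \<union> C)"
        proof (rule inj_onI)
          fix i j assume ij: "i \<in> A \<union> C" "j \<in> A \<union> C" "?\<upsilon> i = ?\<upsilon> j"
          have \<tau>m: "m \<le> \<tau> k" if "k \<in> C" for k using that by (simp add: C_def)
          consider "i \<in> A" "j \<in> A" | "i \<in> A" "j \<in> C" "j \<notin> A" | "i \<in> C" "i \<notin> A" "j \<in> A"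
            | "i \<in> C" "i \<notin> A" "j \<in> C" "j \<notin> A" using ij by blast
          then show "i = j"
          proof cases
            case 1 then show ?thesis using ij(3) A(2) by (simp add: inj_on_eq_iff)
          next
            case 2 then show ?thesis using ij(3) \<sigma>m[of i] \<tau>m[of j] by simp
          next
            case 3 then show ?thesis using ij(3) \<sigma>m[of j] \<tau>m[of i] by simp
          next
            case 4 then show ?thesis using ij(3) B(2) by (simp add: inj_on_eq_iff C_def)
          qed
        qed
        then have "orlicz_sum \<phi> w (A \<union> C) ?\<upsilon> x \<le> M" using A(1) fC by (intro le_M) auto
        then show ?thesis using 1 2 A(3) by simp
      qed
      ultimately show ?thesis by simp
    qed
    then have "orlicz_lorentz_modular \<phi> w (tail_seq m x) \<le> ennreal (2 * e)" if "m \<ge> max m0 m1" for m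
      unfolding orlicz_lorentz_modular_le_iff[OF \<phi> w] using that by (auto intro!: ennreal_leI)
    then show ?thesis unfolding eventually_sequentially by blast
  qed
  show ?thesis
  proof (rule order_tendstoI)
    fix a :: ennreal assume "0 < a"
    then obtain r where r: "0 < ennreal r" "ennreal r < a"
      by (metis dense ennreal_cases less_top_ennreal top.not_eq_extremum less_trans)
    then have "r > 0" by simp
    with small[of "r / 2"] have "\<forall>\<^sub>F m in sequentially. orlicz_lorentz_modular \<phi> w (tail_seq m x) \<le> ennreal r"
      by simp
    then show "\<forall>\<^sub>F m in sequentially. orlicz_lorentz_modular \<phi> w (tail_seq m x) < a"
      by eventually_elim (use r in auto)
  qed simp
qed

text \<open>Apart from the tail property, each axiom reduces to finite sums with fixed
  \<open>A\<close> and \<sigma> through the supremum formula.\<close>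

lemma sequence_modular_orlicz_lorentz:
  assumes \<phi>: "orlicz_function \<phi>" "nondegenerate \<phi>" and w: "weight_sequence w"
  shows "sequence_modular (orlicz_lorentz_modular \<phi> w)"
proof
  let ?\<rho> = "orlicz_lorentz_modular \<phi> w"
  have w0: "0 \<le> w i" for i using w by (simp add: weight_sequence_def less_imp_le)
  note le_iff = orlicz_lorentz_modular_le_iff[OF \<phi> w]
  note upper = orlicz_sum_le_modular[OF \<phi> w]
  note nonneg = orlicz_sum_nonneg[OF \<phi>(1) w]
  have "?\<rho> 0 \<le> 0"
    unfolding le_iff by (simp add: orlicz_sum_def orlicz_zero[OF \<phi>(1)])
  then show "?\<rho> 0 = 0" by simp
  show "x = 0" if "?\<rho> x = 0" for x
  proof
    fix i
    \<comment> \<open>This choice puts the positive weight \<open>w 0\<close> on the single entry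
      \<open>x i\<close>.\<close>
    have "ennreal (orlicz_sum \<phi> w {0} (\<lambda>_. i) x) \<le> 0"
      using upper[of "{0}" "\<lambda>_. i" x] that by simp
    then have "orlicz_sum \<phi> w {0} (\<lambda>_. i) x \<le> 0" by (simp add: ennreal_eq_0_iff)
    then have "\<phi> \<bar>x i\<bar> * w 0 \<le> 0" by (simp add: orlicz_sum_def)
    moreover have "w 0 > 0" using w by (simp add: weight_sequence_def)
    ultimately have "\<phi> \<bar>x i\<bar> \<le> 0" by (simp add: mult_le_0_iff)
    then show "x i = 0 i"
      using \<phi>(2) unfolding nondegenerate_def by (metis not_le zero_fun_apply zero_less_abs_iff)
  qed
  show "?\<rho> x \<le> ?\<rho> y" if "\<And>i. \<bar>x i\<bar> \<le> \<bar>y i\<bar>" for x y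
    unfolding le_iff[of x]
  proof (intro allI impI)
    fix A :: "nat set" and \<sigma> :: "nat \<Rightarrow> nat" assume A: "finite A" "inj_on \<sigma> A"
    have "orlicz_sum \<phi> w A \<sigma> x \<le> orlicz_sum \<phi> w A \<sigma> y"
      unfolding orlicz_sum_def using that w0
      by (intro sum_mono mult_right_mono orlicz_mono[OF \<phi>(1)]) auto
    then show "ennreal (orlicz_sum \<phi> w A \<sigma> x) \<le> ?\<rho> y"
      using upper[OF A, of y] by (meson ennreal_leI order_trans)
  qed
  show "?\<rho> ((1 - t) *\<^sub>R x + t *\<^sub>R y) \<le> ennreal (1 - t) * ?\<rho> x + ennreal t * ?\<rho> y"
    if t: "0 \<le> t" "t \<le> 1" for t x y
    unfolding le_iff
  proof (intro allI impI)
    fix A :: "nat set" and \<sigma> :: "nat \<Rightarrow> nat" assume A: "finite A" "inj_on \<sigma> A"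
    have pt: "\<phi> \<bar>((1 - t) *\<^sub>R x + t *\<^sub>R y) j\<bar> \<le> (1 - t) * \<phi> \<bar>x j\<bar> + t * \<phi> \<bar>y j\<bar>" for j
    proof -
      have "\<phi> \<bar>((1 - t) *\<^sub>R x + t *\<^sub>R y) j\<bar> \<le> \<phi> ((1 - t) * \<bar>x j\<bar> + t * \<bar>y j\<bar>)"
        using abs_triangle_ineq[of "(1 - t) * x j" "t * y j"] t
        by (intro orlicz_mono[OF \<phi>(1)]) (auto simp: scaleR_fun_def abs_mult)
      also have "\<dots> \<le> (1 - t) * \<phi> \<bar>x j\<bar> + t * \<phi> \<bar>y j\<bar>"
        by (rule orlicz_convex[OF \<phi>(1)]) (use t in auto)
      finally show ?thesis .
    qed
    have "orlicz_sum \<phi> w A \<sigma> ((1 - t) *\<^sub>R x + t *\<^sub>R y)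
        \<le> (\<Sum>i\<in>A. ((1 - t) * \<phi> \<bar>x (\<sigma> i)\<bar> + t * \<phi> \<bar>y (\<sigma> i)\<bar>) * w i)"
      unfolding orlicz_sum_def by (intro sum_mono mult_right_mono pt w0)
    also have "\<dots> = (1 - t) * orlicz_sum \<phi> w A \<sigma> x + t * orlicz_sum \<phi> w A \<sigma> y"
      by (simp add: orlicz_sum_def sum_distrib_left sum.distrib distrib_right mult.assoc)
    finally have "ennreal (orlicz_sum \<phi> w A \<sigma> ((1 - t) *\<^sub>R x + t *\<^sub>R y)) \<le>
        ennreal ((1 - t) * orlicz_sum \<phi> w A \<sigma> x + t * orlicz_sum \<phi> w A \<sigma> y)"
      by (rule ennreal_leI)
    also have "\<dots> = ennreal (1 - t) * ennreal (orlicz_sum \<phi> w A \<sigma> x) +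
        ennreal t * ennreal (orlicz_sum \<phi> w A \<sigma> y)"
      using t nonneg by (simp add: ennreal_plus ennreal_mult)
    also have "\<dots> \<le> ennreal (1 - t) * ?\<rho> x + ennreal t * ?\<rho> y"
      by (intro add_mono mult_left_mono upper A) auto
    finally show "ennreal (orlicz_sum \<phi> w A \<sigma> ((1 - t) *\<^sub>R x + t *\<^sub>R y))
        \<le> ennreal (1 - t) * ?\<rho> x + ennreal t * ?\<rho> y" .
  qed
  show "?\<rho> x \<le> c" if lim: "\<And>i. (\<lambda>k. u k i) \<longlonglongrightarrow> x i" and le: "\<And>k. ?\<rho> (u k) \<le> c" for u x c
    unfolding le_iff
  proof (intro allI impI)
    fix A :: "nat set" and \<sigma> :: "nat \<Rightarrow> nat" assume A: "finite A" "inj_on \<sigma> A"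
    have "(\<lambda>k. orlicz_sum \<phi> w A \<sigma> (u k)) \<longlonglongrightarrow> orlicz_sum \<phi> w A \<sigma> x"
      unfolding orlicz_sum_def
      by (intro tendsto_sum tendsto_mult_right orlicz_tendsto[OF \<phi>(1)] tendsto_rabs lim) simp
    then have "(\<lambda>k. ennreal (orlicz_sum \<phi> w A \<sigma> (u k))) \<longlonglongrightarrow> ennreal (orlicz_sum \<phi> w A \<sigma> x)"
      by (rule tendsto_ennrealI)
    then show "ennreal (orlicz_sum \<phi> w A \<sigma> x) \<le> c"
      by (rule LIMSEQ_le_const2) (use order_trans[OF upper[OF A] le] in blast)
  qed
  show "?\<rho> (x + y) \<le> ?\<rho> x + ?\<rho> y" if disj: "\<And>i. x i = 0 \<or> y i = 0" for x y
    unfolding le_iff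
  proof (intro allI impI)
    fix A :: "nat set" and \<sigma> :: "nat \<Rightarrow> nat" assume A: "finite A" "inj_on \<sigma> A"
    have "\<phi> \<bar>(x + y) j\<bar> = \<phi> \<bar>x j\<bar> + \<phi> \<bar>y j\<bar>" for j
      using disj[of j] orlicz_zero[OF \<phi>(1)] by auto
    then have "orlicz_sum \<phi> w A \<sigma> (x + y) = orlicz_sum \<phi> w A \<sigma> x + orlicz_sum \<phi> w A \<sigma> y"
      by (simp add: orlicz_sum_def distrib_right sum.distrib del: plus_fun_apply)
    then show "ennreal (orlicz_sum \<phi> w A \<sigma> (x + y)) \<le> ?\<rho> x + ?\<rho> y"
      using add_mono[OF upper[OF A, of x] upper[OF A, of y]] nonneg by (simp add: ennreal_plus)
  qed
  show "(\<lambda>m. ?\<rho> (tail_seq m x)) \<longlonglongrightarrow> 0" if "?\<rho> x < \<infinity>" for x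
    by (rule orlicz_modular_tail[OF \<phi> w that])
  have "?\<rho> (unit_seq i) \<le> ennreal (\<phi> 1 * w 0)" for i
    unfolding le_iff
  proof (intro allI impI ennreal_leI)
    fix A :: "nat set" and \<sigma> :: "nat \<Rightarrow> nat" assume A: "finite A" "inj_on \<sigma> A"
    have p: "0 \<le> \<phi> 1 * w 0" using orlicz_nonneg[OF \<phi>(1), of 1] w0 by simp
    \<comment> \<open>By injectivity at most one weight meets the single nonzero entry.\<close>
    have "orlicz_sum \<phi> w A \<sigma> (unit_seq i) = (\<Sum>j\<in>{j \<in> A. \<sigma> j = i}. \<phi> 1 * w j)"
      unfolding orlicz_sum_def
      by (rule sum.mono_neutral_cong_right) (use A orlicz_zero[OF \<phi>(1)] in \<open>auto simp: unit_seq_def\<close>)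
    also have "\<dots> \<le> (\<Sum>j\<in>{j \<in> A. \<sigma> j = i}. \<phi> 1 * w 0)"
      using w orlicz_nonneg[OF \<phi>(1), of 1]
      by (intro sum_mono mult_left_mono) (auto simp: weight_sequence_def decseqD)
    also have "\<dots> = real (card {j \<in> A. \<sigma> j = i}) * (\<phi> 1 * w 0)" by simp
    also have "\<dots> \<le> 1 * (\<phi> 1 * w 0)"
    proof (rule mult_right_mono[OF _ p])
      have "card {j \<in> A. \<sigma> j = i} \<le> Suc 0"
        using A by (auto simp: card_le_Suc0_iff_eq inj_on_def)
      then show "real (card {j \<in> A. \<sigma> j = i}) \<le> 1" by simp
    qed
    finally show "orlicz_sum \<phi> w A \<sigma> (unit_seq i) \<le> \<phi> 1 * w 0" by simp
  qed
  then show "?\<rho> (unit_seq i) < \<infinity>" for i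
    by (rule le_less_trans) simp
qed

theorem theorem3p11:
  fixes \<phi> :: "real \<Rightarrow> real" and w :: "nat \<Rightarrow> real"
  assumes "orlicz_function \<phi>" and "nondegenerate \<phi>" and "weight_sequence w"
  shows "M_ideal
           (order_continuous_part (orlicz_lorentz_space \<phi> w) (luxemburg_norm \<phi> w))
           (orlicz_lorentz_space \<phi> w) (luxemburg_norm \<phi> w)"
proof -
  interpret sequence_modular "orlicz_lorentz_modular \<phi> w"
    by (rule sequence_modular_orlicz_lorentz) fact+
  have "modular_space (orlicz_lorentz_modular \<phi> w) = orlicz_lorentz_space \<phi> w"
    by (simp add: modular_space_def orlicz_lorentz_space_def)
  moreover have "modular_norm (orlicz_lorentz_modular \<phi> w) = luxemburg_norm \<phi> w"
    by (rule ext) (simp add: modular_norm_def luxemburg_norm_def)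
  ultimately show ?thesis using M_ideal_order_continuous_part by simp
qed

end
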